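(* Let $n\ge2$ be an integer that is not of the form $2^{\ell}$ for any positive integer $\ell$. If $0.4371985206<r\le0.4384471872$, then $$V(P,\alpha_n(I))<V(P,\beta_n(I')),$$ where $\alpha_n(I)$ and $\beta_n(I')$ are the sets defined in the context (with arbitrary admissible index sets $I$, $I'$ and arbitrary choices of the sets $A_\sigma$), and $V(P,\alpha_n(I))$, $V(P,\beta_n(I'))$ denote their distortion errors.
   Context: Let $0<r<\frac12$, $S_1(x)=rx$, $S_2(x)=rx+(1-r)$ on $\mathbb R$; $P$ is the unique Borel probability measure on $\mathbb R$ with $P=\frac12P\circ S_1^{-1}+\frac12P\circ S_2^{-1}$. For a word $\sigma=\sigma_1\cdots\sigma_k\in\{1,2\}^k$ put $S_\sigma=S_{\sigma_1}\circ\cdots\circ S_{\sigma_k}$ and $J_\sigma=S_\sigma([0,1])$; $\emptyset$ is the empty word ($S_\emptyset=\mathrm{id}$, $\{1,2\}^0=\{\emptyset\}$), and $\sigma\tau$ denotes concatenation. For words $\beta,\dots,\delta$, $a(\beta,\dots,\delta)=\frac{1}{P(J_\beta\cup\cdots\cup J_\delta)}\int_{J_\beta\cup\cdots\cup J_\delta}x\,dP(x)$. The distortion error of a finite set $\alpha\subset\mathbb R$ is $V(P,\alpha)=\int\min_{a\in\alpha}(x-a)^2\,dP(x)$. For each word $\sigma$, $A_\sigma$ denotes one of the two sets (chosen arbitrarily and independently for each $\sigma$) $\{a(\sigma11,\sigma121,\sigma1221),\ a(\sigma1222,\sigma21),\ a(\sigma22)\}$ or $\{a(\sigma11),\ a(\sigma12,\sigma2111),\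 a(\sigma2112,\sigma212,\sigma22)\}$. Let $n\geq 2$ not be a power of $2$ and let $\ell=\ell(n)$ be the integer with $2^{\ell}<n<2^{\ell+1}$. Definition of $\alpha_n(I)$. (1) If $n=2^{\ell}+k$ with $1\le k\le2^{\ell-1}$, then $I\subseteq\{1,2\}^{\ell-1}$ with $\mathrm{card}(I)=k$ and $\alpha_n(I)=\bigcup_{\sigma\in I}A_\sigma\cup\{S_{\sigma1}(\frac12),S_{\sigma2}(\frac12):\sigma\in\{1,2\}^{\ell-1}\setminus I\}$ (so $\alpha_n(I)=\bigcup_{\sigma\in I}A_\sigma$ if $k=2^{\ell-1}$, and $\alpha_3(I)=A_\emptyset$). (2) If $n=3\cdot2^{\ell-1}+k$ with $1\le k\le2^{\ell-1}-1$, then $I\subseteq\{1,2\}^{\ell-1}$ with $\mathrm{card}(I)=k$ and $\alpha_n(I)=\bigcup_{\sigma\in\{1,2\}^{\ell-1}\setminus I}A_\sigma\cup\{S_{\sigma\tau}(\frac12):\sigma\in I,\ \tau\in\{1,2\}^2\}$. Definition of $\beta_n(I')$. For $I'\subset\{1,2\}^{\ell}$ with $\mathrm{card}(I')=n-2^{\ell}$, $\beta_n(I')=\{a_\sigma:\sigma\in\{1,2\}^{\ell}\setminus I'\}\cup\{a_{\sigma1}:\sigma\in I'\}\cup\{a_{\sigma2}:\sigma\in I'\}$, where $a_\sigma=S_\sigma(\frac12)$ is the midpoint of $J_\sigma$. *)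

theory Defs
  imports "HOL-Probability.Probability"
begin

text \<open>Words over the alphabet \<open>{1, 2}\<close> are lists of naturals; the letter \<open>i\<close> stands for \<open>S\<^sub>i\<close>.\<close>

definition words :: "nat \<Rightarrow> nat list set" where
  "words k = {\<sigma> \<in> lists {1, 2}. length \<sigma> = k}"

definition S1 :: "real \<Rightarrow> real \<Rightarrow> real" where
  "S1 r x = r * x"

definition S2 :: "real \<Rightarrow> real \<Rightarrow> real" where
  "S2 r x = r * x + (1 - r)"

text \<open>\<open>Sw r [i\<^sub>1, \<dots>, i\<^sub>k]\<close> applies the map of the last letter first.\<close>

fun Sw :: "real \<Rightarrow> nat list \<Rightarrow> real \<Rightarrow> real" where
  "Sw r [] = id"
| "Sw r (i # \<sigma>) = (if i = 1 then S1 r else S2 r) \<circ> Sw r \<sigma>"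

definition J :: "real \<Rightarrow> nat list \<Rightarrow> real set" where
  "J r \<sigma> = Sw r \<sigma> ` {0..1}"

text \<open>For \<open>0 < r < 1/2\<close> exactly one measure satisfies this predicate (Hutchinson), so that
  statements about the self-similar measure are stated for every \<open>P\<close> satisfying it.\<close>

definition cantor_distribution :: "real \<Rightarrow> real measure \<Rightarrow> bool" where
  "cantor_distribution r P \<longleftrightarrow>
     prob_space P \<and> sets P = sets borel \<and>
     (\<forall>B\<in>sets borel. measure P B = 1/2 * measure P (S1 r -` B) + 1/2 * measure P (S2 r -` B))"

definition cond_mean :: "real \<Rightarrow> real measure \<Rightarrow> nat list set \<Rightarrow> real" where
  "cond_mean r P W =
     1 / measure P (\<Union>\<beta>\<in>W. J r \<beta>) * (LINT x:(\<Union>\<beta>\<in>W. J r \<beta>)|P. x)"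

text \<open>Used for finite nonempty \<open>\<alpha>\<close> only.\<close>

definition distortion :: "real measure \<Rightarrow> real set \<Rightarrow> real" where
  "distortion P \<alpha> = (LINT x|P. Min ((\<lambda>a. (x - a)\<^sup>2) ` \<alpha>))"

definition A_left :: "real \<Rightarrow> real measure \<Rightarrow> nat list \<Rightarrow> real set" where
  "A_left r P \<sigma> =
     {cond_mean r P {\<sigma> @ [1,1], \<sigma> @ [1,2,1], \<sigma> @ [1,2,2,1]},
      cond_mean r P {\<sigma> @ [1,2,2,2], \<sigma> @ [2,1]},
      cond_mean r P {\<sigma> @ [2,2]}}"

definition A_right :: "real \<Rightarrow> real measure \<Rightarrow> nat list \<Rightarrow> real set" where
  "A_right r P \<sigma> =
     {cond_mean r P {\<sigma> @ [1,1]},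
      cond_mean r P {\<sigma> @ [1,2], \<sigma> @ [2,1,1,1]},
      cond_mean r P {\<sigma> @ [2,1,1,2], \<sigma> @ [2,1,2], \<sigma> @ [2,2]}}"

definition admissible_choice :: "real \<Rightarrow> real measure \<Rightarrow> (nat list \<Rightarrow> real set) \<Rightarrow> bool" where
  "admissible_choice r P A \<longleftrightarrow> (\<forall>\<sigma>\<in>lists {1, 2}. A \<sigma> = A_left r P \<sigma> \<or> A \<sigma> = A_right r P \<sigma>)"

text \<open>Meaningful when \<open>n \<ge> 2\<close> is not a power of 2; then \<open>ell n \<ge> 1\<close>.\<close>

definition ell :: "nat \<Rightarrow> nat" where
  "ell n = (THE l. 2 ^ l < n \<and> n < 2 ^ (l + 1))"

lemma ell_eqI:
  assumes "2 ^ l < n" "n < 2 ^ (l + 1)"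
  shows "ell n = l"
  unfolding ell_def
proof (rule the_equality)
  fix m :: nat
  assume m: "2 ^ m < n \<and> n < 2 ^ (m + 1)"
  have "(2::nat) ^ m < 2 ^ (l + 1)" "(2::nat) ^ l < 2 ^ (m + 1)"
    using assms m by linarith+
  hence "m < l + 1" "l < m + 1"
    by (auto simp only: power_strict_increasing_iff[of "2::nat"] one_less_numeral_iff semiring_norm)
  thus "m = l" by simp
qed (use assms in simp)

text \<open>Since \<open>2 ^ ell n < n < 2 ^ (ell n + 1)\<close>, the two ranges of \<open>k\<close> in the definition of
  \<open>\<alpha>\<^sub>n(I)\<close>, namely \<open>n = 2\<^sup>l + k\<close> with \<open>1 \<le> k \<le> 2 ^ (l - 1)\<close> and \<open>n = 3 * 2 ^ (l - 1) + k\<close> with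
  \<open>1 \<le> k \<le> 2 ^ (l - 1) - 1\<close>, are told apart by whether \<open>n \<le> 3 * 2 ^ (l - 1)\<close>.\<close>

definition alpha_index :: "nat \<Rightarrow> nat list set \<Rightarrow> bool" where
  "alpha_index n I \<longleftrightarrow> I \<subseteq> words (ell n - 1) \<and>
     card I = (if n \<le> 3 * 2 ^ (ell n - 1) then n - 2 ^ ell n else n - 3 * 2 ^ (ell n - 1))"

definition alpha_set :: "real \<Rightarrow> (nat list \<Rightarrow> real set) \<Rightarrow> nat \<Rightarrow> nat list set \<Rightarrow> real set" where
  "alpha_set r A n I =
     (if n \<le> 3 * 2 ^ (ell n - 1)
      then (\<Union>\<sigma>\<in>I. A \<sigma>) \<union>
           (\<Union>\<sigma>\<in>words (ell n - 1) - I. {Sw r (\<sigma> @ [1]) (1/2), Sw r (\<sigma> @ [2]) (1/2)})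
      else (\<Union>\<sigma>\<in>words (ell n - 1) - I. A \<sigma>) \<union>
           {Sw r (\<sigma> @ \<tau>) (1/2) |\<sigma> \<tau>. \<sigma> \<in> I \<and> \<tau> \<in> words 2})"

definition beta_index :: "nat \<Rightarrow> nat list set \<Rightarrow> bool" where
  "beta_index n I' \<longleftrightarrow> I' \<subseteq> words (ell n) \<and> card I' = n - 2 ^ ell n"

definition beta_set :: "real \<Rightarrow> nat \<Rightarrow> nat list set \<Rightarrow> real set" where
  "beta_set r n I' =
     {Sw r \<sigma> (1/2) |\<sigma>. \<sigma> \<in> words (ell n) - I'} \<union>
     {Sw r (\<sigma> @ [1]) (1/2) |\<sigma>. \<sigma> \<in> I'} \<union>
     {Sw r (\<sigma> @ [2]) (1/2) |\<sigma>. \<sigma> \<in> I'}"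

end

theory Submission
  imports Defs "HOL-Library.Sublist"
begin

text \<open>Both sets are assembled from blocks sitting in the cylinders \<open>J\<^sub>\<tau>\<close> of level \<open>l - 1\<close>, where
  \<open>l = ell n\<close>, and a block in \<open>J\<^sub>\<tau>\<close> is the copy under \<open>S\<^sub>\<tau>\<close> of one in the unit interval. A block of two,
  three or four points has, in units of the variance \<open>V = (1 - r) / (4 (1 + r))\<close> and after rescaling,

  \<^item> the error \<open>r\<^sup>2\<close>, for the midpoints of the two halves;
  \<^item> the error \<open>(r\<^sup>2 + r\<^sup>4) / 2\<close>, for three midpoints, one half having been split;
  \<^item> the error \<open>(r\<^sup>2 + r\<^sup>4) / 2 + gain r\<close> at most, for a set \<open>A\<^sub>\<tau>\<close>;
  \<^item> the error \<open>r\<^sup>4\<close>, for four midpoints.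

  Here \<open>gain\<close> is an explicit polynomial that is negative for \<open>r\<close> between \<open>0.43719852058...\<close> and \<open>1/2\<close>.
  The error of three midpoints is the average of those of two and of four. Hence the error of
  \<open>\<beta>\<^sub>n(I')\<close>, up to the tiny correction described below, depends on \<open>n\<close> only, not on how \<open>I'\<close> is spread
  over the blocks, and may be computed as if as many blocks as possible consisted of three points. These are the blocks that \<open>\<alpha>\<^sub>n(I)\<close> replaces by the better sets
  \<open>A\<^sub>\<tau>\<close>, and there is at least one of them because \<open>n\<close> is not a power of two.

  For \<open>\<alpha>\<^sub>n(I)\<close> an upper bound suffices, so each piece of the support may be assigned to any point at
  will (lemma \<open>cell_three_point\<close>). For \<open>\<beta>\<^sub>n(I')\<close> a lower bound is needed, that is, one has to know that no
  point is much closer than the midpoint of the cylinder (lemma \<open>distortion_beta_ge\<close>). This is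
  delicate at one place: the upper end of the range of \<open>r\<close> exceeds \<open>(5 - sqrt 17) / 2\<close> by less than
  \<open>10 ^ (- 11)\<close>, and between these two numbers the endpoint of an unsplit cylinder is a little closer
  to a point of its split sibling. The error term \<open>loss\<close> accounts for this, and lemma \<open>margin\<close> shows
  that the gain outweighs it.\<close>

section \<open>Words and their similarities\<close>

lemma Sw_append: "Sw r (u @ v) x = Sw r u (Sw r v x)"
  by (induction u) auto

lemma Sw_diff: "Sw r w x - Sw r w y = r ^ length w * (x - y)"
proof (induction w)
  case (Cons i w)
  have "Sw r (i # w) x - Sw r (i # w) y = r * (Sw r w x - Sw r w y)"
    by (auto simp: S1_def S2_def algebra_simps)
  with Cons show ?case by simp
qed simp

lemma Sw_affine: "Sw r w x = r ^ length w * x + Sw r w 0"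
  using Sw_diff[of r w x 0] by simp

lemma continuous_on_Sw: "continuous_on A (Sw r w)"
proof -
  have "continuous_on A (\<lambda>x. r ^ length w * x + Sw r w 0)"
    by (intro continuous_intros)
  then show ?thesis by (simp only: Sw_affine[symmetric])
qed

lemma words_0: "words 0 = {[]}"
  by (auto simp: words_def)

lemma words_Suc: "words (Suc k) = (#) 1 ` words k \<union> (#) 2 ` words k"
proof (rule set_eqI)
  fix w show "w \<in> words (Suc k) \<longleftrightarrow> w \<in> (#) 1 ` words k \<union> (#) 2 ` words k"
    by (cases w) (auto simp: words_def)
qed

lemma finite_words: "finite (words k)"
  by (induction k) (simp_all add: words_0 words_Suc)

lemma sum_words_Suc:
  fixes g :: "nat list \<Rightarrow> 'a :: comm_monoid_add"
  shows "(\<Sum>w\<in>words (Suc k). g w) = (\<Sum>w\<in>words k. g (1 # w)) + (\<Sum>w\<in>words k. g (2 # w))"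
proof -
  have "(#) 1 ` words k \<inter> (#) 2 ` words k = {}" by auto
  then show ?thesis
    by (simp add: words_Suc sum.union_disjoint finite_words sum.reindex inj_on_def)
qed

lemma sum_words_Suc_snoc:
  fixes g :: "nat list \<Rightarrow> 'a :: comm_monoid_add"
  shows "(\<Sum>w\<in>words (Suc k). g w) = (\<Sum>w\<in>words k. g (w @ [1]) + g (w @ [2]))"
proof (induction k arbitrary: g)
  case 0
  show ?case using sum_words_Suc[of g 0] by (simp add: words_0)
next
  case (Suc k)
  show ?case
    by (subst sum_words_Suc, subst (1 2) Suc.IH, subst sum_words_Suc) simp
qed

lemma card_words: "card (words k) = 2 ^ k"
proof (induction k)
  case (Suc k)
  show ?case using sum_words_Suc[of "\<lambda>_. 1::nat" k] Suc by simp
qed (simp add: words_0)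

lemma words_SucE:
  assumes "w \<in> words (Suc k)"
  obtains u i where "w = u @ [i]" "u \<in> words k" "i \<in> {1, 2}"
proof (cases w rule: rev_cases)
  case Nil
  then show ?thesis using assms by (simp add: words_def)
next
  case (snoc u i)
  then show ?thesis using assms that[of u i] by (auto simp: words_def)
qed

lemma parallel_of_same_length: "length u = length w \<Longrightarrow> u \<noteq> w \<Longrightarrow> u \<parallel> w"
  by (metis (no_types) parallelI prefix_def append_eq_append_conv append_Nil2)

locale contraction_ratio =
  fixes r :: real
  assumes r_pos: "0 < r" and r_half: "r < 1/2"
begin

lemma Sw_unit: "x \<in> {0..1} \<Longrightarrow> Sw r w x \<in> {0..1}"
proof (induction w)
  case (Cons i w)
  have "0 \<le> r * y \<and> r * y \<le> r" if "y \<in> {0..1}" for y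
    using that r_pos by (auto simp: mult_left_le)
  from this[OF Cons.IH[OF Cons.prems]] have "0 \<le> r * Sw r w x" "r * Sw r w x \<le> r" by auto
  then show ?case
    using r_half by (cases "i = 1") (simp_all add: S1_def S2_def)
qed simp

text \<open>Where two words first differ, their images lie in \<open>S\<^sub>v([0,1])\<close> for the common prefix \<open>v\<close>,
  on different sides of its central gap, which has length \<open>(1 - 2 r) r ^ |v|\<close>; and
  \<open>|v| \<le> |u| - 1\<close>.\<close>

lemma separation:
  assumes u: "u \<in> lists {1, 2}" and w: "w \<in> lists {1, 2}" and par: "u \<parallel> w"
    and x: "x \<in> {0..1}" and y: "y \<in> {0..1}"
  shows "(1 - 2 * r) * r ^ (length u - 1) \<le> \<bar>Sw r u x - Sw r w y\<bar>"
proof -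
  obtain v b bs c cs where bc: "b \<noteq> c" and ueq: "u = v @ b # bs" and weq: "w = v @ c # cs"
    using parallel_decomp[OF par] by blast
  have letters: "b \<in> {1, 2}" "c \<in> {1, 2}" using u w ueq weq by auto
  let ?x = "Sw r bs x" and ?y = "Sw r cs y"
  have range: "0 \<le> r * z" "r * z \<le> r" if "z \<in> {0..1}" for z
    using that r_pos by (auto simp: mult_left_le)
  have xy: "?x \<in> {0..1}" "?y \<in> {0..1}" using Sw_unit x y by auto
  have "1 - 2 * r \<le> \<bar>Sw r [b] ?x - Sw r [c] ?y\<bar>"
    using bc letters range[OF xy(1)] range[OF xy(2)] r_half by (auto simp: S1_def S2_def)
  then have "r ^ length v * (1 - 2 * r) \<le> r ^ length v * \<bar>Sw r [b] ?x - Sw r [c] ?y\<bar>"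
    using r_pos by (intro mult_left_mono) auto
  also have "\<dots> = \<bar>Sw r v (Sw r [b] ?x) - Sw r v (Sw r [c] ?y)\<bar>"
    using r_pos by (simp only: Sw_diff abs_mult) simp
  also have "\<dots> = \<bar>Sw r u x - Sw r w y\<bar>"
    unfolding ueq weq by (simp add: Sw_append)
  finally have "r ^ length v * (1 - 2 * r) \<le> \<bar>Sw r u x - Sw r w y\<bar>" .
  moreover have "r ^ (length u - 1) \<le> r ^ length v"
    using ueq r_pos r_half by (intro power_decreasing) auto
  then have "(1 - 2 * r) * r ^ (length u - 1) \<le> r ^ length v * (1 - 2 * r)"
    using r_half by (simp add: mult.commute mult_right_mono)
  ultimately show ?thesis by linarith
qed

end

section \<open>Integration against the self-similar measure\<close>

text \<open>The integrands that occur: since \<open>P\<close> lives on the unit interval, boundedness there makes them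
  integrable, and the class is closed under composition with the maps \<open>S\<^sub>w\<close>. Continuous functions
  alone would not do, because the conditional means call for indicators.\<close>

definition unit_bounded :: "(real \<Rightarrow> real) \<Rightarrow> bool" where
  "unit_bounded f \<longleftrightarrow> f \<in> borel_measurable borel \<and> (\<exists>B. \<forall>x\<in>{0..1}. \<bar>f x\<bar> \<le> B)"

lemma unit_bounded_continuous:
  assumes "continuous_on UNIV f"
  shows "unit_bounded f"
proof -
  have "bounded (f ` {0..1})"
    by (intro compact_imp_bounded compact_continuous_image continuous_on_subset[OF assms]) auto
  then show ?thesis
    using borel_measurable_continuous_onI[OF assms]
    unfolding unit_bounded_def bounded_iff by auto
qed

lemma unit_bounded_Min_sq:
  assumes "finite \<alpha>" "\<alpha> \<noteq> {}"
  shows "unit_bounded (\<lambda>x. Min ((\<lambda>a. (x - a)\<^sup>2) ` \<alpha>))"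
proof -
  obtain a where a: "a \<in> \<alpha>" using assms by blast
  have "\<bar>Min ((\<lambda>a. (x - a)\<^sup>2) ` \<alpha>)\<bar> \<le> (1 + \<bar>a\<bar>)\<^sup>2" if "x \<in> {0..1}" for x
  proof -
    have "Min ((\<lambda>a. (x - a)\<^sup>2) ` \<alpha>) \<le> (x - a)\<^sup>2" using a assms by simp
    also have "\<bar>x - a\<bar> \<le> \<bar>1 + \<bar>a\<bar>\<bar>" using that by auto
    then have "(x - a)\<^sup>2 \<le> (1 + \<bar>a\<bar>)\<^sup>2" using abs_le_square_iff[of "x - a" "1 + \<bar>a\<bar>"] by blast
    finally have "Min ((\<lambda>a. (x - a)\<^sup>2) ` \<alpha>) \<le> (1 + \<bar>a\<bar>)\<^sup>2" .
    moreover have "0 \<le> Min ((\<lambda>a. (x - a)\<^sup>2) ` \<alpha>)" using assms by (intro Min.boundedI) auto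
    ultimately show ?thesis by simp
  qed
  moreover have "(\<lambda>x. Min ((\<lambda>a. (x - a)\<^sup>2) ` \<alpha>)) \<in> borel_measurable borel"
    using assms by (intro borel_measurable_Min) auto
  ultimately show ?thesis unfolding unit_bounded_def by (intro conjI exI[of _ "(1 + \<bar>a\<bar>)\<^sup>2"]) auto
qed

locale cantor = contraction_ratio +
  fixes P :: "real measure"
  assumes cantor: "cantor_distribution r P"
begin

sublocale prob_space P
  using cantor unfolding cantor_distribution_def by (elim conjE)

lemma sets_P [measurable_cong]: "sets P = sets borel"
  using cantor unfolding cantor_distribution_def by (elim conjE)

lemma space_P [simp]: "space P = UNIV"
  using sets_eq_imp_space_eq[OF sets_P] by simp

lemma measure_split:
  "B \<in> sets borel \<Longrightarrow> prob B = 1/2 * prob (S1 r -` B) + 1/2 * prob (S2 r -` B)"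
  using cantor unfolding cantor_distribution_def by (elim conjE) (rule bspec)

lemma S_measurable [measurable]:
  "S1 r \<in> borel_measurable borel" "S2 r \<in> borel_measurable borel"
  unfolding S1_def[abs_def] S2_def[abs_def] by measurable

lemma Sw_measurable [measurable]: "Sw r w \<in> borel_measurable borel"
  by (intro borel_measurable_continuous_onI continuous_on_Sw)

text \<open>Both maps send \<open>[-R/r, 1 + R/r]\<close> into \<open>[-R, 1 + R]\<close>: an excess over the unit interval shrinks
  by the factor \<open>r\<close>. Iterating, every neighbourhood of the unit interval carries as much mass as
  arbitrarily large intervals, that is, all of it.\<close>

lemma prob_interval_mono:
  assumes "R > 0"
  shows "prob {-(R/r)..1 + R/r} \<le> prob {-R..1 + R}"
proof -
  have "1 \<le> 1/r" "R * 1 \<le> R * (1/r)" using r_pos r_half assms by (auto intro!: mult_left_mono simp: field_simps)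
  have "{-(R/r)..1 + R/r} \<subseteq> S1 r -` {-R..1 + R}"
  proof
    fix x assume "x \<in> {-(R/r)..1 + R/r}"
    then have "r * (-(R/r)) \<le> r * x" "r * x \<le> r * (1 + R/r)"
      using r_pos by (auto simp only: mult_le_cancel_left_pos atLeastAtMost_iff)
    then have "-R \<le> r * x" "r * x \<le> r + R" using r_pos by (simp_all add: distrib_left)
    then show "x \<in> S1 r -` {-R..1 + R}" using r_half by (simp add: S1_def)
  qed
  moreover have "{-(R/r)..1 + R/r} \<subseteq> S2 r -` {-R..1 + R}"
  proof
    fix x assume "x \<in> {-(R/r)..1 + R/r}"
    then have "r * (-(R/r)) \<le> r * x" "r * x \<le> r * (1 + R/r)"
      using r_pos by (auto simp only: mult_le_cancel_left_pos atLeastAtMost_iff)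
    then have "-R \<le> r * x" "r * x \<le> r + R" using r_pos by (simp_all add: distrib_left)
    then show "x \<in> S2 r -` {-R..1 + R}" using r_half by (simp add: S2_def)
  qed
  moreover have "S1 r -` {-R..1 + R} \<in> events" "S2 r -` {-R..1 + R} \<in> events"
    using measurable_sets_borel[OF S_measurable(1), of "{-R..1+R}"]
      measurable_sets_borel[OF S_measurable(2), of "{-R..1+R}"] by (auto simp: sets_P)
  ultimately have "prob {-(R/r)..1 + R/r} \<le> prob (S1 r -` {-R..1 + R})"
    "prob {-(R/r)..1 + R/r} \<le> prob (S2 r -` {-R..1 + R})"
    by (auto intro!: finite_measure_mono)
  then show ?thesis using measure_split[of "{-R..1 + R}"] by simp
qed

lemma prob_interval: 
  assumes "R > 0"
  shows "prob {-R..1 + R} = 1"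
proof -
  let ?B = "\<lambda>n. {-(R / r ^ n)..1 + R / r ^ n}"
  have mono: "prob (?B n) \<le> prob {-R..1 + R}" for n
  proof (induction n)
    case (Suc n)
    have "prob (?B (Suc n)) \<le> prob (?B n)"
      using prob_interval_mono[of "R / r ^ n"] assms r_pos by (simp add: field_simps)
    with Suc show ?case by simp
  qed simp
  have "incseq ?B"
  proof (rule incseq_SucI)
    fix n
    have "R / r ^ n \<le> R / r ^ Suc n"
      using assms r_pos r_half by (intro divide_left_mono) (auto simp: mult_left_le_one_le)
    then show "?B n \<subseteq> ?B (Suc n)" by auto
  qed
  moreover have "(\<Union>n. ?B n) = UNIV"
  proof (auto)
    fix x :: real
    obtain n where "\<bar>x\<bar> / R < (1 / r) ^ n"
      using real_arch_pow[of "1 / r" "\<bar>x\<bar> / R"] r_pos r_half by auto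
    then have "R / r ^ n \<ge> \<bar>x\<bar>" using assms by (simp add: field_simps power_one_over)
    then have "- (R / r ^ n) \<le> x \<and> x \<le> 1 + R / r ^ n" by linarith
    then show "\<exists>n. - (R / r ^ n) \<le> x \<and> x \<le> 1 + R / r ^ n" ..
  qed
  ultimately have "(\<lambda>n. prob (?B n)) \<longlonglongrightarrow> prob UNIV"
    using finite_Lim_measure_incseq[of ?B] by (simp add: sets_P image_subset_iff)
  then have "prob UNIV \<le> prob {-R..1 + R}"
    by (rule LIMSEQ_le_const2) (use mono in auto)
  then show ?thesis using prob_space prob_le_1[of "{-R..1 + R}"] by (simp add: antisym)
qed

lemma AE_unit: "AE x in P. x \<in> {0..1}"
proof -
  have "AE x in P. \<forall>n. x \<in> {-(1 / real (Suc n))..1 + 1 / real (Suc n)}"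
  proof (subst AE_all_countable, rule allI)
    fix n
    show "AE x in P. x \<in> {-(1 / real (Suc n))..1 + 1 / real (Suc n)}"
      by (subst AE_in_set_eq_1) (auto simp: sets_P simp del: of_nat_Suc intro!: prob_interval)
  qed
  then show ?thesis
  proof (rule AE_mp, intro AE_I2 impI)
    fix x :: real
    assume all: "\<forall>n. x \<in> {-(1 / real (Suc n))..1 + 1 / real (Suc n)}"
    have lim: "(\<lambda>n. 1 / real (Suc n)) \<longlonglongrightarrow> 0" by (rule lim_1_over_n[THEN LIMSEQ_Suc])
    have "-0 \<le> x"
      by (rule LIMSEQ_le_const2[OF tendsto_minus[OF lim]]) (use all in auto)
    moreover have "x \<le> 1 + 0"
      by (rule LIMSEQ_le_const[OF tendsto_add[OF tendsto_const lim]]) (use all in auto)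
    ultimately show "x \<in> {0..1}" by simp
  qed
qed

lemma nn_integral_split:
  fixes f :: "real \<Rightarrow> ennreal"
  assumes "f \<in> borel_measurable borel"
  shows "(\<integral>\<^sup>+x. f x \<partial>P) = ennreal (1/2) * (\<integral>\<^sup>+x. f (S1 r x) \<partial>P) + ennreal (1/2) * (\<integral>\<^sup>+x. f (S2 r x) \<partial>P)"
  using assms
proof (induction rule: borel_measurable_induct)
  case (cong f g)
  then show ?case by (simp cong: nn_integral_cong)
next
  case (set B)
  have B: "S1 r -` B \<in> events" "S2 r -` B \<in> events" "B \<in> events"
    using set measurable_sets_borel[OF S_measurable(1), of B]
      measurable_sets_borel[OF S_measurable(2), of B] by (auto simp: sets_P)
  have ind: "indicator B (g x) = (indicator (g -` B) x :: ennreal)" for g :: "real \<Rightarrow> real" and x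
    by (auto simp: indicator_def)
  have "ennreal (prob B) = ennreal (1/2) * ennreal (prob (S1 r -` B)) + ennreal (1/2) * ennreal (prob (S2 r -` B))"
    by (subst measure_split) (use set in \<open>simp_all add: ennreal_mult'[symmetric] ennreal_plus[symmetric] del: ennreal_plus ennreal_half\<close>)
  then show ?case using B by (simp add: ind emeasure_eq_measure)
next
  case (mult u c)
  then show ?case by (simp add: nn_integral_cmult distrib_left mult.left_commute)
next
  case (add u v)
  then show ?case by (simp add: nn_integral_add algebra_simps)
next
  case (seq U)
  have inc: "incseq (\<lambda>i. ennreal (1/2) * (\<integral>\<^sup>+x. U i (g x) \<partial>P))" for g
    using seq by (auto simp: incseq_def le_fun_def intro!: nn_integral_mono mult_left_mono)
  have lim: "(\<integral>\<^sup>+x. (SUP i. U i (g x)) \<partial>P) = (SUP i. \<integral>\<^sup>+x. U i (g x) \<partial>P)"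
    if "g \<in> borel_measurable borel" for g
    using seq that by (intro nn_integral_monotone_convergence_SUP) (auto simp: incseq_def le_fun_def)
  show ?case
    using lim[of "\<lambda>x. x", OF measurable_ident_sets[OF refl]] lim[OF S_measurable(1)] lim[OF S_measurable(2)]
    by (simp only: SUP_apply image_comp seq.IH SUP_mult_left_ennreal ennreal_SUP_add[OF inc inc])
qed

lemma integrable_unit_bounded: "unit_bounded f \<Longrightarrow> integrable P f"
proof -
  assume f: "unit_bounded f"
  then obtain B where B: "\<bar>f x\<bar> \<le> B" if "x \<in> {0..1}" for x
    unfolding unit_bounded_def by blast
  show "integrable P f"
  proof (rule integrable_const_bound)
    show "AE x in P. norm (f x) \<le> B"
      by (rule AE_mp[OF AE_unit]) (use B in \<open>auto intro!: AE_I2\<close>)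
    show "f \<in> borel_measurable P"
      using f by (simp add: unit_bounded_def measurable_cong_sets[OF sets_P refl])
  qed
qed

lemma unit_bounded_comp_Sw: "unit_bounded f \<Longrightarrow> unit_bounded (\<lambda>x. f (Sw r w x))"
  unfolding unit_bounded_def using Sw_unit by (auto 0 3)

lemma integral_mono_unit:
  assumes "unit_bounded f" "unit_bounded g" "\<And>x. x \<in> {0..1} \<Longrightarrow> f x \<le> g x"
  shows "(LINT x|P. f x) \<le> (LINT x|P. g x)"
  by (rule integral_mono_AE) (use assms integrable_unit_bounded AE_unit in \<open>auto elim!: AE_mp\<close>)

text \<open>Self-similarity passes from sets to nonnegative functions by monotone convergence, and then to
  bounded ones by adding a constant \<open>B\<close> that makes them nonnegative.\<close>

lemma integral_split:
  assumes f: "unit_bounded f"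
  shows "(LINT x|P. f x) = 1/2 * (LINT x|P. f (Sw r [1] x)) + 1/2 * (LINT x|P. f (Sw r [2] x))"
proof -
  obtain B where B: "\<bar>f x\<bar> \<le> B" if "x \<in> {0..1}" for x
    using f unfolding unit_bounded_def by blast
  have meas [measurable]: "f \<in> borel_measurable borel" using f by (simp add: unit_bounded_def)
  have *: "(\<integral>\<^sup>+x. ennreal (f (Sw r w x) + B) \<partial>P) = ennreal ((LINT x|P. f (Sw r w x)) + B)"
    "0 \<le> (LINT x|P. f (Sw r w x)) + B" for w
  proof -
    have int: "integrable P (\<lambda>x. f (Sw r w x))"
      by (intro integrable_unit_bounded unit_bounded_comp_Sw f)
    have ae: "AE x in P. 0 \<le> f (Sw r w x) + B"
    proof (rule AE_mp[OF AE_unit], intro AE_I2 impI)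
      fix x :: real assume "x \<in> {0..1}"
      from B[OF Sw_unit[OF this], of w] show "0 \<le> f (Sw r w x) + B" by linarith
    qed
    have "integral\<^sup>L P (\<lambda>x. f (Sw r w x) + B) = (LINT x|P. f (Sw r w x)) + B"
      using int by (subst Bochner_Integration.integral_add) (auto simp: prob_space[simplified])
    then show "(\<integral>\<^sup>+x. ennreal (f (Sw r w x) + B) \<partial>P) = ennreal ((LINT x|P. f (Sw r w x)) + B)"
      "0 \<le> (LINT x|P. f (Sw r w x)) + B"
      using nn_integral_eq_integral[of P "\<lambda>x. f (Sw r w x) + B"] int ae
        integral_nonneg_AE[OF ae] by auto
  qed
  have "ennreal ((LINT x|P. f x) + B) =
      ennreal (1/2) * ennreal ((LINT x|P. f (Sw r [1] x)) + B) + ennreal (1/2) * ennreal ((LINT x|P. f (Sw r [2] x)) + B)"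
    using nn_integral_split[of "\<lambda>x. ennreal (f x + B)"] *[of "[]"] *[of "[1]"] *[of "[2]"] by simp
  also have "\<dots> = ennreal (1/2 * ((LINT x|P. f (Sw r [1] x)) + B) + 1/2 * ((LINT x|P. f (Sw r [2] x)) + B))"
    using *(2)[of "[1]"] *(2)[of "[2]"] by (simp only: ennreal_mult'[symmetric] ennreal_plus[symmetric]) (simp add: ennreal_mult'[symmetric] ennreal_plus[symmetric] del: ennreal_plus ennreal_half)
  finally have "(LINT x|P. f x) + B = 1/2 * ((LINT x|P. f (Sw r [1] x)) + B) + 1/2 * ((LINT x|P. f (Sw r [2] x)) + B)"
    using *(2)[of "[]"] *(2)[of "[1]"] *(2)[of "[2]"] by (subst (asm) ennreal_inj) auto
  then show ?thesis by (simp add: field_simps)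
qed

lemma integral_node:
  assumes "unit_bounded f"
  shows "(LINT x|P. f (Sw r w x)) =
    1/2 * (LINT x|P. f (Sw r (w @ [1]) x)) + 1/2 * (LINT x|P. f (Sw r (w @ [2]) x))"
  using integral_split[OF unit_bounded_comp_Sw[OF assms]] by (simp add: Sw_append)

lemma integral_words:
  assumes "unit_bounded f"
  shows "(LINT x|P. f x) = (\<Sum>w\<in>words k. (1/2) ^ k * (LINT x|P. f (Sw r w x)))"
proof (induction k)
  case 0
  then show ?case by (simp add: words_0)
next
  case (Suc k)
  show ?case unfolding Suc
    by (subst sum_words_Suc_snoc, intro sum.cong refl, subst integral_node[OF assms])
       (simp add: algebra_simps)
qed

text \<open>Applied to \<open>x\<close> and to \<open>(x - 1/2)\<^sup>2\<close>, the self-similarity of the integral is a linear equation for the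
  mean and for the variance.\<close>

lemma mean: "(LINT x|P. x) = 1/2"
proof -
  have id: "unit_bounded (\<lambda>x. x)" by (intro unit_bounded_continuous continuous_intros)
  then have int: "integrable P (\<lambda>x. x)" by (rule integrable_unit_bounded)
  have "(LINT x|P. x) = 1/2 * (LINT x|P. r * x) + 1/2 * (LINT x|P. r * x + (1 - r))"
    using integral_split[OF id] by (simp add: S1_def S2_def)
  also have "(LINT x|P. r * x + (1 - r)) = r * (LINT x|P. x) + (1 - r)"
    using int by (simp add: prob_space[simplified])
  finally have "(1 - r) * (LINT x|P. x) = (1 - r) * (1/2)" by (simp add: algebra_simps)
  then show ?thesis using r_half by (simp only: mult_cancel_left) linarith
qed

text \<open>The variance of \<open>P\<close>.\<close>

definition V :: real where
  "V = (1 - r) / (4 * (1 + r))"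

lemma second_moment_about: "(LINT x|P. (x - c)\<^sup>2) = V + (c - 1/2)\<^sup>2"
proof -
  have sq: "unit_bounded (\<lambda>x. (x - c)\<^sup>2)" for c by (intro unit_bounded_continuous continuous_intros)
  have id: "integrable P (\<lambda>x. x)"
    by (intro integrable_unit_bounded unit_bounded_continuous continuous_intros)
  have int: "integrable P (\<lambda>x. (x - c)\<^sup>2)" for c by (intro integrable_unit_bounded sq)
  have shift: "(LINT x|P. (x - c)\<^sup>2) = (LINT x|P. (x - 1/2)\<^sup>2) + (c - 1/2)\<^sup>2" for c
  proof -
    have "(LINT x|P. (x - c)\<^sup>2) = (LINT x|P. ((x - 1/2)\<^sup>2 + (1 - 2 * c) * x) + (c\<^sup>2 - 1/4))"
      by (intro Bochner_Integration.integral_cong) (auto simp: power2_eq_square field_simps)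
    also have "\<dots> = (LINT x|P. (x - 1/2)\<^sup>2) + (1 - 2 * c) * (LINT x|P. x) + (c\<^sup>2 - 1/4)"
      using int[of "1/2"] id by (simp add: prob_space[simplified])
    finally show ?thesis by (simp add: mean power2_eq_square field_simps)
  qed
  have scale: "(LINT x|P. (r * x - c)\<^sup>2) = r\<^sup>2 * (LINT x|P. (x - c / r)\<^sup>2)" for c
  proof -
    have "(r * x - c)\<^sup>2 = r\<^sup>2 * (x - c / r)\<^sup>2" for x
      using r_pos by (simp add: power_mult_distrib[symmetric] right_diff_distrib)
    then show ?thesis by simp
  qed
  define v where "v = (LINT x|P. (x - 1/2)\<^sup>2)"
  have "v = 1/2 * (LINT x|P. (r * x - 1/2)\<^sup>2) + 1/2 * (LINT x|P. (r * x - (r - 1/2))\<^sup>2)"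
    unfolding v_def using integral_split[OF sq[of "1/2"]] by (simp add: S1_def S2_def algebra_simps)
  also have "\<dots> = 1/2 * (r\<^sup>2 * (v + (1/2 / r - 1/2)\<^sup>2)) + 1/2 * (r\<^sup>2 * (v + ((r - 1/2) / r - 1/2)\<^sup>2))"
    unfolding scale shift[of "1/2 / r"] shift[of "(r - 1/2) / r"] v_def ..
  also have "\<dots> = r\<^sup>2 * v + ((1 - r) / 2)\<^sup>2"
    using r_pos by (simp add: power2_eq_square field_simps)
  finally have fixpoint: "v = r\<^sup>2 * v + ((1 - r) / 2)\<^sup>2" .
  have "(1 - r) * ((1 + r) * v) = v - r\<^sup>2 * v" by (simp add: power2_eq_square algebra_simps)
  also have "\<dots> = ((1 - r) / 2)\<^sup>2" using fixpoint by linarith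
  also have "\<dots> = (1 - r) * ((1 - r) / 4)" by (simp add: power2_eq_square)
  finally have "(1 - r) * ((1 + r) * v) = (1 - r) * ((1 - r) / 4)" .
  then have "(1 + r) * v = (1 - r) / 4" using r_half by (simp only: mult_cancel_left) linarith
  then have "v = V" using r_pos by (simp add: V_def field_simps)
  then show ?thesis using shift[of c] by (simp add: v_def)
qed

lemma V_pos: "V > 0"
  using r_pos r_half by (simp add: V_def)

lemma second_moment_word:
  "(LINT x|P. (Sw r w x - c)\<^sup>2) = r ^ (2 * length w) * V + (Sw r w (1/2) - c)\<^sup>2"
proof -
  let ?q = "r ^ length w" and ?d = "Sw r w (1/2) - c"
  have q: "?q > 0" using r_pos by simp
  have "(Sw r w x - c)\<^sup>2 = ?q\<^sup>2 * (x - (1/2 - ?d / ?q))\<^sup>2" for x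
  proof -
    have "Sw r w x - c = ?q * (x - 1/2) + ?d" using Sw_diff[of r w x "1/2"] by simp
    also have "\<dots> = ?q * (x - (1/2 - ?d / ?q))"
      using nonzero_mult_div_cancel_left[of ?q ?d] q
      by (simp only: right_diff_distrib times_divide_eq_right)
    finally show ?thesis by (simp only: power_mult_distrib)
  qed
  then have "(LINT x|P. (Sw r w x - c)\<^sup>2) = ?q\<^sup>2 * (V + (?d / ?q)\<^sup>2)"
    by (simp add: second_moment_about)
  also have "\<dots> = ?q\<^sup>2 * V + ?d\<^sup>2" using q r_pos by (simp add: power_divide distrib_left)
  also have "?q\<^sup>2 = r ^ (2 * length w)" by (simp add: power_mult[symmetric] mult.commute)
  finally show ?thesis .
qed

lemma unit_bounded_sq: "unit_bounded (\<lambda>x. (x - c)\<^sup>2)"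
  by (intro unit_bounded_continuous continuous_intros)

subsection \<open>Integrals over cylinder sets\<close>

lemma J_borel: "J r w \<in> sets borel"
proof -
  have "compact (J r w)" unfolding J_def
    by (intro compact_continuous_image continuous_on_Sw) auto
  then show ?thesis by (intro borel_closed compact_imp_closed)
qed

lemma J_disjoint:
  assumes "u \<in> lists {1, 2}" "w \<in> lists {1, 2}" "u \<parallel> w"
  shows "J r u \<inter> J r w = {}"
proof (rule ccontr)
  assume "J r u \<inter> J r w \<noteq> {}"
  then obtain x y where xy: "x \<in> {0..1}" "y \<in> {0..1}" "Sw r u x = Sw r w y"
    unfolding J_def by blast
  have "0 < (1 - 2 * r) * r ^ (length u - 1)" using r_pos r_half by simp
  with separation[OF assms xy(1,2)] xy(3) show False by simp
qed

lemma unit_bounded_indicator_mult: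
  assumes "B \<in> sets borel" "unit_bounded f"
  shows "unit_bounded (\<lambda>x. indicator B x * f x)"
proof -
  obtain C where C: "\<bar>f x\<bar> \<le> C" if "x \<in> {0..1}" for x using assms(2) unfolding unit_bounded_def by blast
  have "\<bar>indicator B x * f x\<bar> \<le> C" if "x \<in> {0..1}" for x
    using C[OF that] by (auto simp: indicator_def)
  moreover have "(\<lambda>x. indicator B x * f x) \<in> borel_measurable borel"
    using assms by (auto simp: unit_bounded_def)
  ultimately show ?thesis unfolding unit_bounded_def by blast
qed

text \<open>Expand over all words of the length of \<open>w\<close>: every summand but that of \<open>w\<close> vanishes, because
  cylinders of the same level are disjoint.\<close>

lemma set_integral_J:
  assumes w: "w \<in> lists {1, 2}" and f: "unit_bounded f"
  shows "(LINT x|P. indicator (J r w) x * f x) = (1/2) ^ length w * (LINT x|P. f (Sw r w x))"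
proof -
  let ?k = "length w" and ?g = "\<lambda>x. indicator (J r w) x * f x"
  have g: "unit_bounded ?g" by (intro unit_bounded_indicator_mult J_borel f)
  have wk: "w \<in> words ?k" using w by (simp add: words_def)
  have *: "(LINT x|P. ?g (Sw r v x)) = (if v = w then (LINT x|P. f (Sw r w x)) else 0)"
    if v: "v \<in> words ?k" for v
  proof -
    have "AE x in P. ?g (Sw r v x) = (if v = w then f (Sw r w x) else 0)"
    proof (rule AE_mp[OF AE_unit], intro AE_I2 impI)
      fix x :: real assume x: "x \<in> {0..1}"
      then have "Sw r v x \<in> J r v" by (simp add: J_def)
      moreover have "J r v \<inter> J r w = {}" if "v \<noteq> w"
        using v w that by (intro J_disjoint parallel_of_same_length) (auto simp: words_def)
      ultimately show "?g (Sw r v x) = (if v = w then f (Sw r w x) else 0)"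
        by (auto simp: indicator_def)
    qed
    then have "(LINT x|P. ?g (Sw r v x)) = (LINT x|P. (if v = w then f (Sw r w x) else 0))"
      using integrable_unit_bounded[OF unit_bounded_comp_Sw[OF g, of v]]
        integrable_unit_bounded[OF unit_bounded_comp_Sw[OF f, of w]]
      by (intro integral_cong_AE) (auto dest: borel_measurable_integrable)
    then show ?thesis by simp
  qed
  have "(LINT x|P. ?g x) = (\<Sum>v\<in>words ?k. (1/2) ^ ?k * (LINT x|P. ?g (Sw r v x)))"
    by (rule integral_words[OF g])
  also have "\<dots> = (\<Sum>v\<in>words ?k. if v = w then (1/2) ^ ?k * (LINT x|P. f (Sw r w x)) else 0)"
    by (intro sum.cong refl) (simp add: *)
  also have "\<dots> = (1/2) ^ ?k * (LINT x|P. f (Sw r w x))"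
    using wk by (simp add: finite_words)
  finally show ?thesis .
qed

lemma integral_Sw: "(LINT x|P. Sw r w x) = Sw r w (1/2)"
proof -
  have "integrable P (\<lambda>x. x)"
    by (intro integrable_unit_bounded unit_bounded_continuous continuous_intros)
  then have "(LINT x|P. r ^ length w * x + Sw r w 0) = r ^ length w * (1/2) + Sw r w 0"
    by (simp add: mean prob_space[simplified])
  then show ?thesis by (simp only: Sw_affine[symmetric])
qed

text \<open>The conditional mean over a union of disjoint cylinders is the average of their midpoints, with
  the masses \<open>2 ^ (- |w|)\<close> as weights. Averages commute with the affine map \<open>S\<^sub>\<sigma>\<close>, so that both
  choices for \<open>A\<^sub>\<sigma>\<close> are the images of a pattern for the empty word.\<close>

definition weighted_mean :: "nat list set \<Rightarrow> real" where
  "weighted_mean W = (\<Sum>w\<in>W. (1/2) ^ length w * Sw r w (1/2)) / (\<Sum>w\<in>W. (1/2) ^ length w)"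

lemma cond_mean_words:
  assumes W: "finite W" "W \<subseteq> lists {1, 2}" and par: "pairwise (\<parallel>) W"
  shows "cond_mean r P W = weighted_mean W"
proof -
  have disj: "disjoint_family_on (J r) W"
    unfolding disjoint_family_on_def
    using W par J_disjoint by (auto simp: pairwise_def subset_iff)
  have ind: "indicator (\<Union>w\<in>W. J r w) x = (\<Sum>w\<in>W. indicator (J r w) x :: real)" for x
    by (rule indicator_UN_disjoint[OF W(1) disj])
  have *: "(LINT x|P. indicator (\<Union>w\<in>W. J r w) x * f x) = (\<Sum>w\<in>W. (1/2) ^ length w * (LINT x|P. f (Sw r w x)))"
    if f: "unit_bounded f" for f
  proof -
    have "(LINT x|P. indicator (\<Union>w\<in>W. J r w) x * f x) = (LINT x|P. (\<Sum>w\<in>W. indicator (J r w) x * f x))"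
      by (simp only: ind sum_distrib_right)
    also have "\<dots> = (\<Sum>w\<in>W. (LINT x|P. indicator (J r w) x * f x))"
      by (intro Bochner_Integration.integral_sum integrable_unit_bounded unit_bounded_indicator_mult J_borel f)
    finally show ?thesis using set_integral_J[OF _ f] W by (simp add: subset_iff)
  qed
  have "prob (\<Union>w\<in>W. J r w) = (LINT x|P. indicator (\<Union>w\<in>W. J r w) x * 1)"
    by simp
  also have "\<dots> = (\<Sum>w\<in>W. (1/2) ^ length w)"
    by (subst *) (auto intro!: unit_bounded_continuous continuous_intros simp: prob_space[simplified])
  finally have "prob (\<Union>w\<in>W. J r w) = (\<Sum>w\<in>W. (1/2) ^ length w)" .
  moreover have "(LINT x:(\<Union>w\<in>W. J r w)|P. x) = (\<Sum>w\<in>W. (1/2) ^ length w * Sw r w (1/2))"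
    unfolding set_lebesgue_integral_def real_scaleR_def
    by (subst *) (auto intro!: unit_bounded_continuous continuous_intros simp: integral_Sw)
  ultimately show ?thesis by (simp add: cond_mean_def weighted_mean_def)
qed

lemma weighted_mean_append:
  assumes "finite W" "W \<noteq> {}"
  shows "weighted_mean ((@) \<sigma> ` W) = Sw r \<sigma> (weighted_mean W)"
proof -
  let ?p = "\<Sum>w\<in>W. (1/2::real) ^ length w" and ?q = "(1/2::real) ^ length \<sigma>"
  have inj: "inj_on ((@) \<sigma>) W" by (simp add: inj_on_def)
  have p: "?p > 0" using assms by (intro sum_pos) auto
  have "(\<Sum>w\<in>W. (1/2) ^ length w * Sw r \<sigma> (Sw r w (1/2)))
      = (\<Sum>w\<in>W. r ^ length \<sigma> * ((1/2) ^ length w * Sw r w (1/2)) + Sw r \<sigma> 0 * (1/2) ^ length w)"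
    by (intro sum.cong refl, subst Sw_affine) (simp add: algebra_simps)
  also have "\<dots> = r ^ length \<sigma> * (\<Sum>w\<in>W. (1/2) ^ length w * Sw r w (1/2)) + Sw r \<sigma> 0 * ?p"
    by (simp only: sum.distrib sum_distrib_left)
  finally have num: "(\<Sum>w\<in>W. (1/2) ^ length w * Sw r \<sigma> (Sw r w (1/2))) = \<dots>" .
  have "weighted_mean ((@) \<sigma> ` W) = (?q * (\<Sum>w\<in>W. (1/2) ^ length w * Sw r \<sigma> (Sw r w (1/2)))) / (?q * ?p)"
    by (simp add: weighted_mean_def sum.reindex[OF inj] power_add Sw_append sum_distrib_left mult.assoc)
  also have "\<dots> = (\<Sum>w\<in>W. (1/2) ^ length w * Sw r \<sigma> (Sw r w (1/2))) / ?p"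
    by simp
  also have "\<dots> = r ^ length \<sigma> * weighted_mean W + Sw r \<sigma> 0"
    using p by (simp add: num weighted_mean_def add_divide_distrib)
  also have "\<dots> = Sw r \<sigma> (weighted_mean W)" by (simp only: Sw_affine[symmetric])
  finally show ?thesis .
qed

lemma cond_mean_append:
  assumes "finite W" "W \<noteq> {}" "W \<subseteq> lists {1, 2}" "pairwise (\<parallel>) W" "\<sigma> \<in> lists {1, 2}"
  shows "cond_mean r P ((@) \<sigma> ` W) = Sw r \<sigma> (weighted_mean W)"
proof -
  have "cond_mean r P ((@) \<sigma> ` W) = weighted_mean ((@) \<sigma> ` W)"
  proof (rule cond_mean_words)
    show "(@) \<sigma> ` W \<subseteq> lists {1, 2}"
      using assms(3,5) by (metis append_in_lists_conv image_subsetI subsetD)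
    show "pairwise (\<parallel>) ((@) \<sigma> ` W)"
      using assms(4) by (auto simp: pairwise_def parallel_def)
  qed (use assms in simp)
  then show ?thesis using weighted_mean_append[OF assms(1,2)] by simp
qed

lemma A_left_eq:
  assumes "\<sigma> \<in> lists {1, 2}"
  shows "A_left r P \<sigma> = Sw r \<sigma> `
    {weighted_mean {[1,1], [1,2,1], [1,2,2,1]}, weighted_mean {[1,2,2,2], [2,1]}, weighted_mean {[2,2]}}"
  unfolding A_left_def
  using cond_mean_append[of "{[1,1], [1,2,1], [1,2,2,1]}" \<sigma>] cond_mean_append[of "{[1,2,2,2], [2,1]}" \<sigma>]
    cond_mean_append[of "{[2,2]}" \<sigma>] assms
  by (simp add: pairwise_def parallel_def)

lemma A_right_eq:
  assumes "\<sigma> \<in> lists {1, 2}"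
  shows "A_right r P \<sigma> = Sw r \<sigma> `
    {weighted_mean {[1,1]}, weighted_mean {[1,2], [2,1,1,1]}, weighted_mean {[2,1,1,2], [2,1,2], [2,2]}}"
  unfolding A_right_def
  using cond_mean_append[of "{[2,1,1,2], [2,1,2], [2,2]}" \<sigma>] cond_mean_append[of "{[1,2], [2,1,1,1]}" \<sigma>]
    cond_mean_append[of "{[1,1]}" \<sigma>] assms
  by (simp add: pairwise_def parallel_def)

end

section \<open>The three-point pattern\<close>

text \<open>Dividing \<open>J\<^sub>\<emptyset>\<close> among the three points of a pattern gives the error
  \<open>V * three_point_error r\<close>. Splitting one of the two cylinders of level one gives
  \<open>V r\<^sup>2 (1 + r\<^sup>2) / 2\<close>. The polynomial \<open>gain\<close> measures the difference; where it is negative, the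
  pattern wins. Its zero \<open>0.43719852058...\<close> lies just below the interval considered.\<close>

definition gain :: "real \<Rightarrow> real" where
  "gain r = (28 - 56 * r - 38 * r^2 + 36 * r^3 + 15 * r^4 + 14 * r^5 - 8 * r^6 + 6 * r^7 + 3 * r^8) / 140"

definition three_point_error :: "real \<Rightarrow> real" where
  "three_point_error r = r\<^sup>2 * (1 + r\<^sup>2) / 2 + gain r"

text \<open>Each summand is the mass of a cylinder times the squared distance from its midpoint to the
  centre that serves it: the part of the three-point error not caused by the variance inside
  the cylinders.\<close>

lemma three_point_left_identity:
  fixes r :: real
  shows "1/4 * (r^2/2 - (3/7 * r + r^4/14))\<^sup>2
    + 1/8 * (r * (r * (r/2) + (1 - r)) - (3/7 * r + r^4/14))\<^sup>2
    + 1/16 * (r * (r * (r * (r/2) + (1 - r)) + (1 - r)) - (3/7 * r + r^4/14))\<^sup>2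
    + 1/16 * (r * (r * (r * (r/2 + (1 - r)) + (1 - r)) + (1 - r)) - (4/5 - 3/5 * r + 2/5 * r^2 - r^4/10))\<^sup>2
    + 1/4 * (r * (r/2) + (1 - r) - (4/5 - 3/5 * r + 2/5 * r^2 - r^4/10))\<^sup>2
    + 1/4 * (r * (r/2 + (1 - r)) + (1 - r) - (1 - r^2/2))\<^sup>2
    = (1 - r) * (56 - 168*r + 232*r^2 - 160*r^3 + 120*r^4 - 92*r^5 + 41*r^6 - 29*r^7) / 1120"
  by (simp add: power2_eq_square power3_eq_cube field_simps power_numeral_reduce)

lemma three_point_error_eq:
  fixes r :: real
  assumes "0 < r"
  shows "(1 - r) / (4 * (1 + r)) * (3/4 * r^4 + 1/8 * r^6 + 1/8 * r^8)
    + (1 - r) * (56 - 168*r + 232*r^2 - 160*r^3 + 120*r^4 - 92*r^5 + 41*r^6 - 29*r^7) / 1120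
    = (1 - r) / (4 * (1 + r)) * three_point_error r" (is "?v * ?w + _ = _")
proof -
  have "(1 - r) * p / 1120 = ?v * ((1 + r) * p / 280)" for p
    using assms by (simp add: field_simps)
  moreover have "three_point_error r
    = ?w + (1 + r) * (56 - 168*r + 232*r^2 - 160*r^3 + 120*r^4 - 92*r^5 + 41*r^6 - 29*r^7) / 280"
    unfolding three_point_error_def gain_def
    by (simp add: field_simps power_numeral_reduce)
  ultimately show ?thesis by (simp only: distrib_left)
qed

text \<open>On this interval the terms \<open>- 56 - 76 x\<close> of \<open>140\<close> times the derivative dominate; crude
  bounds for the powers of \<open>x\<close> suffice for the other terms.\<close>

lemma gain_antimono:
  assumes "0.437 \<le> a" "a < b" "b \<le> 0.4385"
  shows "gain b < gain a"
proof (rule DERIV_neg_imp_decreasing[OF assms(2)])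
  fix x :: real assume ax: "a \<le> x" and xb: "x \<le> b"
  let ?D = "(- 56 - 76 * x + 108 * x^2 + 60 * x^3 + 70 * x^4 - 48 * x^5 + 42 * x^6 + 24 * x^7) / 140"
  have "(gain has_real_derivative ?D) (at x)"
    unfolding gain_def[abs_def] by (auto intro!: derivative_eq_intros)
  moreover have "?D < 0"
  proof -
    have "0 \<le> x" "x \<le> 0.44" using ax xb assms by auto
    then have "x ^ k \<le> 0.44 ^ k" and "0 \<le> x ^ k" for k
      by (auto intro: power_mono)
    from this(1)[of 2] this(1)[of 3] this(1)[of 4] this(1)[of 6] this(1)[of 7] this(2)[of 5]
    have "x ^ 2 \<le> 0.2" "x ^ 3 \<le> 0.1" "x ^ 4 \<le> 0.1" "x ^ 6 \<le> 0.1" "x ^ 7 \<le> 0.1" "0 \<le> x ^ 5"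
      by (simp_all add: power_divide)
    with \<open>0 \<le> x\<close> have "- 56 - 76 * x + 108 * x^2 + 60 * x^3 + 70 * x^4 - 48 * x^5 + 42 * x^6 + 24 * x^7 < 0"
      by linarith
    then show ?thesis by simp
  qed
  ultimately show "\<exists>y. (gain has_real_derivative y) (at x) \<and> y < 0" by blast
qed

lemma gain_at_lower_end: "gain 0.4371985206 < 0"
  by (simp add: gain_def power_divide)

lemma gain_at_0438: "gain 0.438 < - 0.0003"
  by (simp add: gain_def power_divide)

context cantor
begin

text \<open>The error that \<open>\<alpha>\<close> makes on the cylinder \<open>J\<^sub>w\<close>, normalised by the mass of the cylinder.\<close>

definition cell :: "real set \<Rightarrow> nat list \<Rightarrow> real" where
  "cell \<alpha> w = (LINT x|P. Min ((\<lambda>a. (Sw r w x - a)\<^sup>2) ` \<alpha>))"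

lemma cell_split:
  assumes "finite \<alpha>" "\<alpha> \<noteq> {}"
  shows "cell \<alpha> w = 1/2 * cell \<alpha> (w @ [1]) + 1/2 * cell \<alpha> (w @ [2])"
  unfolding cell_def by (rule integral_node[OF unit_bounded_Min_sq[OF assms]])

lemma distortion_cells:
  assumes "finite \<alpha>" "\<alpha> \<noteq> {}"
  shows "distortion P \<alpha> = (\<Sum>w\<in>words k. (1/2) ^ k * cell \<alpha> w)"
  unfolding cell_def distortion_def by (rule integral_words[OF unit_bounded_Min_sq[OF assms]])

lemma unit_bounded_cell:
  assumes "finite \<alpha>" "\<alpha> \<noteq> {}"
  shows "unit_bounded (\<lambda>x. Min ((\<lambda>a. (Sw r w x - a)\<^sup>2) ` \<alpha>))"
  by (rule unit_bounded_comp_Sw[OF unit_bounded_Min_sq[OF assms]])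

text \<open>Serving a whole cylinder by one point never underestimates the error. So upper bounds for
  \<open>\<alpha>\<^sub>n(I)\<close> need no description of its Voronoi regions.\<close>

lemma cell_le:
  assumes "finite \<alpha>" "c \<in> \<alpha>"
  shows "cell \<alpha> w \<le> r ^ (2 * length w) * V + (Sw r w (1/2) - c)\<^sup>2"
proof -
  have "cell \<alpha> w \<le> (LINT x|P. (Sw r w x - c)\<^sup>2)"
    unfolding cell_def
    by (rule integral_mono_unit) (use assms in \<open>auto intro!: unit_bounded_cell unit_bounded_comp_Sw[OF unit_bounded_sq] Min_le\<close>)
  then show ?thesis by (simp only: second_moment_word)
qed

lemma cell_ge:
  assumes "finite \<alpha>" "\<alpha> \<noteq> {}"
    and "\<And>x a. x \<in> {0..1} \<Longrightarrow> a \<in> \<alpha> \<Longrightarrow> p * (x - 1/2)\<^sup>2 - q \<le> (Sw r w x - a)\<^sup>2"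
  shows "p * V - q \<le> cell \<alpha> w"
proof -
  have "(LINT x|P. p * (x - 1/2)\<^sup>2 - q) \<le> cell \<alpha> w"
    unfolding cell_def
  proof (rule integral_mono_unit)
    show "unit_bounded (\<lambda>x. p * (x - 1/2)\<^sup>2 - q)"
      by (intro unit_bounded_continuous continuous_intros)
    show "p * (x - 1/2)\<^sup>2 - q \<le> Min ((\<lambda>a. (Sw r w x - a)\<^sup>2) ` \<alpha>)" if "x \<in> {0..1}" for x
      using assms that by (intro Min.boundedI) auto
  qed (intro unit_bounded_cell assms)
  moreover have "(LINT x|P. p * (x - 1/2)\<^sup>2 - q) = p * V - q"
    using integrable_unit_bounded[OF unit_bounded_sq, of "1/2"]
    by (simp add: second_moment_about prob_space[simplified])
  ultimately show ?thesis by simp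
qed

lemma cell_append_mono:
  assumes "finite \<alpha>" "finite C" "C \<noteq> {}" "Sw r \<sigma> ` C \<subseteq> \<alpha>"
  shows "cell \<alpha> \<sigma> \<le> r ^ (2 * length \<sigma>) * distortion P C"
proof -
  have fin: "\<alpha> \<noteq> {}" using assms by auto
  have "cell \<alpha> \<sigma> \<le> (LINT x|P. r ^ (2 * length \<sigma>) * Min ((\<lambda>a. (x - a)\<^sup>2) ` C))"
    unfolding cell_def
  proof (rule integral_mono_unit)
    show "unit_bounded (\<lambda>x. r ^ (2 * length \<sigma>) * Min ((\<lambda>a. (x - a)\<^sup>2) ` C))"
    proof -
      obtain B where "(\<lambda>x. Min ((\<lambda>a. (x - a)\<^sup>2) ` C)) \<in> borel_measurable borel"
        "\<And>x. x \<in> {0..1} \<Longrightarrow> \<bar>Min ((\<lambda>a. (x - a)\<^sup>2) ` C)\<bar> \<le> B"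
        using unit_bounded_Min_sq[OF assms(2,3)] unfolding unit_bounded_def by blast
      then show ?thesis unfolding unit_bounded_def
        using r_pos by (intro conjI exI[of _ "r ^ (2 * length \<sigma>) * B"]) (auto simp: abs_mult)
    qed
    show "Min ((\<lambda>a. (Sw r \<sigma> x - a)\<^sup>2) ` \<alpha>) \<le> r ^ (2 * length \<sigma>) * Min ((\<lambda>a. (x - a)\<^sup>2) ` C)" for x
    proof -
      have "Min ((\<lambda>a. (x - a)\<^sup>2) ` C) \<in> (\<lambda>a. (x - a)\<^sup>2) ` C" using assms by (intro Min_in) auto
      then obtain c where c: "c \<in> C" "Min ((\<lambda>a. (x - a)\<^sup>2) ` C) = (x - c)\<^sup>2" by auto
      have "Min ((\<lambda>a. (Sw r \<sigma> x - a)\<^sup>2) ` \<alpha>) \<le> (Sw r \<sigma> x - Sw r \<sigma> c)\<^sup>2"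
        using assms c by (intro Min_le) auto
      also have "\<dots> = r ^ (2 * length \<sigma>) * (x - c)\<^sup>2"
        by (simp add: Sw_diff power_mult_distrib power_mult[symmetric] mult.commute)
      finally show ?thesis using c by simp
    qed
  qed (intro unit_bounded_cell assms fin)
  then show ?thesis by (simp add: distortion_def)
qed

lemma distortion_left_pattern:
  "distortion P {weighted_mean {[1,1], [1,2,1], [1,2,2,1]}, weighted_mean {[1,2,2,2], [2,1]}, weighted_mean {[2,2]}}
    \<le> V * three_point_error r"
proof -
  let ?c1 = "3/7 * r + r^4/14" and ?c2 = "4/5 - 3/5 * r + 2/5 * r^2 - r^4/10" and ?c3 = "1 - r^2/2"
  define C where "C = {?c1, ?c2, ?c3}"
  have centres: "weighted_mean {[1,1], [1,2,1], [1,2,2,1]} = ?c1"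
    "weighted_mean {[1,2,2,2], [2,1]} = ?c2" "weighted_mean {[2,2]} = ?c3"
    by (simp_all add: weighted_mean_def S1_def S2_def field_simps power_numeral_reduce)
  have split: "cell C w = 1/2 * cell C (w @ [1]) + 1/2 * cell C (w @ [2])" for w
    by (rule cell_split) (auto simp: C_def)
  have base: "distortion P C = cell C []"
    using distortion_cells[of C 0] by (simp add: words_0 C_def)
  have bound: "cell C w \<le> r ^ n * V + (Sw r w (1/2) - c)\<^sup>2"
    if "c \<in> C" "2 * length w = n" for w c n
    using cell_le[of C c w] that by (simp add: C_def)
  have "distortion P C = 1/4 * cell C [1,1] + 1/8 * cell C [1,2,1] + 1/16 * cell C [1,2,2,1]
      + 1/16 * cell C [1,2,2,2] + 1/4 * cell C [2,1] + 1/4 * cell C [2,2]"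
    using base split[of "[]"] split[of "[1]"] split[of "[1,2]"] split[of "[1,2,2]"] split[of "[2]"]
    unfolding append.simps by linarith
  also have "\<dots> \<le> 1/4 * (r^4 * V + (Sw r [1,1] (1/2) - ?c1)\<^sup>2)
      + 1/8 * (r^6 * V + (Sw r [1,2,1] (1/2) - ?c1)\<^sup>2)
      + 1/16 * (r^8 * V + (Sw r [1,2,2,1] (1/2) - ?c1)\<^sup>2)
      + 1/16 * (r^8 * V + (Sw r [1,2,2,2] (1/2) - ?c2)\<^sup>2)
      + 1/4 * (r^4 * V + (Sw r [2,1] (1/2) - ?c2)\<^sup>2)
      + 1/4 * (r^4 * V + (Sw r [2,2] (1/2) - ?c3)\<^sup>2)"
    by (intro add_mono mult_left_mono bound) (simp_all add: C_def)
  also have "\<dots> = V * (3/4 * r^4 + 1/8 * r^6 + 1/8 * r^8) +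
      (1/4 * (Sw r [1,1] (1/2) - ?c1)\<^sup>2 + 1/8 * (Sw r [1,2,1] (1/2) - ?c1)\<^sup>2
      + 1/16 * (Sw r [1,2,2,1] (1/2) - ?c1)\<^sup>2 + 1/16 * (Sw r [1,2,2,2] (1/2) - ?c2)\<^sup>2
      + 1/4 * (Sw r [2,1] (1/2) - ?c2)\<^sup>2 + 1/4 * (Sw r [2,2] (1/2) - ?c3)\<^sup>2)"
    by (simp only: distrib_left) (simp add: field_simps)
  also have "(1/4 * (Sw r [1,1] (1/2) - ?c1)\<^sup>2 + 1/8 * (Sw r [1,2,1] (1/2) - ?c1)\<^sup>2
      + 1/16 * (Sw r [1,2,2,1] (1/2) - ?c1)\<^sup>2 + 1/16 * (Sw r [1,2,2,2] (1/2) - ?c2)\<^sup>2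
      + 1/4 * (Sw r [2,1] (1/2) - ?c2)\<^sup>2 + 1/4 * (Sw r [2,2] (1/2) - ?c3)\<^sup>2) =
      (1 - r) * (56 - 168*r + 232*r^2 - 160*r^3 + 120*r^4 - 92*r^5 + 41*r^6 - 29*r^7) / 1120"
    by (subst three_point_left_identity[symmetric]) (simp add: S1_def S2_def power2_eq_square mult.assoc)
  also have "V * (3/4 * r^4 + 1/8 * r^6 + 1/8 * r^8) + \<dots> = V * three_point_error r"
    unfolding V_def using r_pos by (rule three_point_error_eq)
  finally show ?thesis unfolding centres C_def .
qed

text \<open>The reflection \<open>x \<mapsto> 1 - x\<close> interchanges the letters and turns the words and centres of this
  pattern into those of the other one, so the same six squared distances occur.\<close>

lemma distortion_right_pattern:
  "distortion P {weighted_mean {[1,1]}, weighted_mean {[1,2], [2,1,1,1]}, weighted_mean {[2,1,1,2], [2,1,2], [2,2]}}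
    \<le> V * three_point_error r"
proof -
  let ?c1 = "3/7 * r + r^4/14" and ?c2 = "4/5 - 3/5 * r + 2/5 * r^2 - r^4/10" and ?c3 = "1 - r^2/2"
  define C where "C = {1 - ?c3, 1 - ?c2, 1 - ?c1}"
  have centres: "weighted_mean {[2,1,1,2], [2,1,2], [2,2]} = 1 - ?c1"
    "weighted_mean {[1,2], [2,1,1,1]} = 1 - ?c2" "weighted_mean {[1,1]} = 1 - ?c3"
    by (simp_all add: weighted_mean_def S1_def S2_def field_simps power_numeral_reduce)
  have split: "cell C w = 1/2 * cell C (w @ [1]) + 1/2 * cell C (w @ [2])" for w
    by (rule cell_split) (auto simp: C_def)
  have base: "distortion P C = cell C []"
    using distortion_cells[of C 0] by (simp add: words_0 C_def)
  have mirror: "Sw r [2,2] (1/2) = 1 - Sw r [1,1] (1/2)" "Sw r [2,1,2] (1/2) = 1 - Sw r [1,2,1] (1/2)"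
    "Sw r [2,1,1,2] (1/2) = 1 - Sw r [1,2,2,1] (1/2)" "Sw r [2,1,1,1] (1/2) = 1 - Sw r [1,2,2,2] (1/2)"
    "Sw r [1,2] (1/2) = 1 - Sw r [2,1] (1/2)" "Sw r [1,1] (1/2) = 1 - Sw r [2,2] (1/2)"
    by (simp_all add: S1_def S2_def algebra_simps)
  have bound: "cell C w \<le> r ^ n * V + (Sw r w' (1/2) - c)\<^sup>2"
    if "1 - c \<in> C" "Sw r w (1/2) = 1 - Sw r w' (1/2)" "2 * length w = n" for w w' c n
    using cell_le[of C "1 - c" w] that by (simp add: C_def power2_commute)
  have "distortion P C = 1/4 * cell C [2,2] + 1/8 * cell C [2,1,2] + 1/16 * cell C [2,1,1,2]
      + 1/16 * cell C [2,1,1,1] + 1/4 * cell C [1,2] + 1/4 * cell C [1,1]"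
    using base split[of "[]"] split[of "[2]"] split[of "[2,1]"] split[of "[2,1,1]"] split[of "[1]"]
    unfolding append.simps by linarith
  also have "\<dots> \<le> 1/4 * (r^4 * V + (Sw r [1,1] (1/2) - ?c1)\<^sup>2)
      + 1/8 * (r^6 * V + (Sw r [1,2,1] (1/2) - ?c1)\<^sup>2)
      + 1/16 * (r^8 * V + (Sw r [1,2,2,1] (1/2) - ?c1)\<^sup>2)
      + 1/16 * (r^8 * V + (Sw r [1,2,2,2] (1/2) - ?c2)\<^sup>2)
      + 1/4 * (r^4 * V + (Sw r [2,1] (1/2) - ?c2)\<^sup>2)
      + 1/4 * (r^4 * V + (Sw r [2,2] (1/2) - ?c3)\<^sup>2)"
    by (intro add_mono mult_left_mono bound[OF _ mirror(1)] bound[OF _ mirror(2)] bound[OF _ mirror(3)]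
        bound[OF _ mirror(4)] bound[OF _ mirror(5)] bound[OF _ mirror(6)]) (simp_all add: C_def)
  also have "\<dots> = V * (3/4 * r^4 + 1/8 * r^6 + 1/8 * r^8) +
      (1/4 * (Sw r [1,1] (1/2) - ?c1)\<^sup>2 + 1/8 * (Sw r [1,2,1] (1/2) - ?c1)\<^sup>2
      + 1/16 * (Sw r [1,2,2,1] (1/2) - ?c1)\<^sup>2 + 1/16 * (Sw r [1,2,2,2] (1/2) - ?c2)\<^sup>2
      + 1/4 * (Sw r [2,1] (1/2) - ?c2)\<^sup>2 + 1/4 * (Sw r [2,2] (1/2) - ?c3)\<^sup>2)"
    by (simp only: distrib_left) (simp add: field_simps)
  also have "(1/4 * (Sw r [1,1] (1/2) - ?c1)\<^sup>2 + 1/8 * (Sw r [1,2,1] (1/2) - ?c1)\<^sup>2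
      + 1/16 * (Sw r [1,2,2,1] (1/2) - ?c1)\<^sup>2 + 1/16 * (Sw r [1,2,2,2] (1/2) - ?c2)\<^sup>2
      + 1/4 * (Sw r [2,1] (1/2) - ?c2)\<^sup>2 + 1/4 * (Sw r [2,2] (1/2) - ?c3)\<^sup>2) =
      (1 - r) * (56 - 168*r + 232*r^2 - 160*r^3 + 120*r^4 - 92*r^5 + 41*r^6 - 29*r^7) / 1120"
    by (subst three_point_left_identity[symmetric]) (simp add: S1_def S2_def power2_eq_square mult.assoc)
  also have "V * (3/4 * r^4 + 1/8 * r^6 + 1/8 * r^8) + \<dots> = V * three_point_error r"
    unfolding V_def using r_pos by (rule three_point_error_eq)
  finally show ?thesis unfolding centres C_def .
qed

lemma cell_three_point:
  assumes A: "A = A_left r P \<sigma> \<or> A = A_right r P \<sigma>" and \<sigma>: "\<sigma> \<in> lists {1, 2}"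
    and \<alpha>: "finite \<alpha>" "A \<subseteq> \<alpha>"
  shows "cell \<alpha> \<sigma> \<le> r ^ (2 * length \<sigma>) * (V * three_point_error r)"
proof -
  obtain C where C: "finite C" "C \<noteq> {}" "A = Sw r \<sigma> ` C" "distortion P C \<le> V * three_point_error r"
    using A A_left_eq[OF \<sigma>] A_right_eq[OF \<sigma>] distortion_left_pattern distortion_right_pattern
    by (metis finite.emptyI finite.insertI insert_not_empty)
  have "cell \<alpha> \<sigma> \<le> r ^ (2 * length \<sigma>) * distortion P C"
    using C \<alpha> by (intro cell_append_mono) auto
  also have "\<dots> \<le> r ^ (2 * length \<sigma>) * (V * three_point_error r)"
    using C(4) r_pos by (intro mult_left_mono) auto
  finally show ?thesis .
qed

end

section \<open>The midpoint configuration\<close>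

lemma ell_bounds:
  assumes "n \<ge> 2" "\<nexists>l::nat. l \<ge> 1 \<and> n = 2 ^ l"
  obtains k where "ell n = Suc k" "2 ^ Suc k < n" "n < 2 ^ Suc (Suc k)"
proof -
  obtain l where l: "2 ^ l \<le> n" "n < 2 ^ (l + 1)"
    using ex_power_ivl1[of 2 n] assms(1) by auto
  have "l \<noteq> 0" using l(2) assms(1) by (cases l) auto
  then obtain k where k: "l = Suc k" by (cases l) auto
  have "2 ^ l \<noteq> n" using assms(2) k by auto
  then have "2 ^ l < n" using l(1) by simp
  then show ?thesis using that[of k] ell_eqI[of l n] l(2) k by simp
qed

locale cantor_window = cantor +
  assumes lower: "0.4371985206 < r" and upper: "r \<le> 0.4384471872"
begin

text \<open>For \<open>r \<le> (5 - sqrt 17) / 2 = 0.438447187191...\<close>, a root of \<open>r\<^sup>2 - 5 r + 2\<close>, the midpoint of an unsplit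
  cylinder \<open>J\<^sub>\<sigma>\<close> is a nearest point of \<open>\<beta>\<^sub>n(I')\<close> for all of \<open>J\<^sub>\<sigma>\<close>. The upper end of the interval
  considered is this root rounded up. Beyond the root, the end of \<open>J\<^sub>\<sigma>\<close> is slightly closer to the nearest point of a
  sibling that has been split. The quantity \<open>loss\<close> bounds the resulting decrease of the squared
  distance, in units in which the common parent of the siblings has length one.\<close>

definition loss :: real where
  "loss = max 0 (5 * r - r\<^sup>2 - 2) / 4"

lemma loss_nonneg: "0 \<le> loss"
  by (simp add: loss_def)

text \<open>The loss vanishes up to \<open>0.438\<close>, where the gain is merely known to be negative; beyond \<open>0.438\<close> the
  gain is bounded away from zero by much more than the tiny loss.\<close>

lemma margin: "V * gain r + loss < 0"
proof -
  have "gain r < gain 0.4371985206"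
    using lower upper by (intro gain_antimono) auto
  then have neg: "gain r < 0" using gain_at_lower_end by linarith
  have factor: "5 * r - r\<^sup>2 - 2 = 5 * c - c * c - 2 - (c - r) * (5 - r - c)" for c
    by (simp add: power2_eq_square algebra_simps)
  show ?thesis
  proof (cases "r \<le> 0.438")
    case True
    have "0 \<le> (0.438 - r) * (5 - r - 0.438)" using True by (intro mult_nonneg_nonneg) auto
    then have "5 * r - r\<^sup>2 - 2 \<le> 0" using factor[of "0.438"] by simp
    then have "loss = 0" by (simp add: loss_def)
    then show ?thesis using neg V_pos by (simp add: mult_pos_neg)
  next
    case False
    have "0 \<le> (0.4384471872 - r) * (5 - r - 0.4384471872)" using upper by (intro mult_nonneg_nonneg) auto
    then have "5 * r - r\<^sup>2 - 2 \<le> 4 / 10^6" using factor[of "0.4384471872"] by simp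
    then have "max 0 (5 * r - r\<^sup>2 - 2) \<le> 4 / 10^6" by (intro max.boundedI) auto
    then have "loss \<le> 1 / 10^6" by (simp add: loss_def)
    moreover have "gain r < - 0.0003"
      using gain_antimono[of "0.438" r] gain_at_0438 False upper by auto
    then have "V * gain r \<le> 0.09 * (- 0.0003)"
    proof -
      assume g: "gain r < - 0.0003"
      have "0.09 \<le> V" using upper r_pos by (simp add: V_def field_simps)
      then have "0.09 * 0.0003 \<le> V * (- gain r)" using g by (intro mult_mono) auto
      then show ?thesis by simp
    qed
    ultimately show ?thesis by simp
  qed
qed

text \<open>Here \<open>1 - r + r\<^sup>2/2\<close> is the left midpoint of the split right sibling, and \<open>s\<close> is the excess for the
  other midpoint. The difference of squares factors, one factor being largest at the endpoint
  \<open>x = 1\<close>, with value \<open>(5 r - r\<^sup>2 - 2) / 2\<close> there.\<close>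

lemma sibling_estimate:
  assumes x: "x \<in> {0..1}" and s: "0 \<le> s"
  shows "r\<^sup>2 * (x - 1/2)\<^sup>2 - loss \<le> (1 - r + r\<^sup>2/2 - r * x + s)\<^sup>2"
proof -
  let ?e = "1 - r + r\<^sup>2/2 - r * x"
  have rx: "r * x \<le> r" using x r_pos by (simp add: mult_left_le)
  have e: "0 \<le> ?e" using rx r_half zero_le_power2[of r] by linarith
  have "r\<^sup>2 * (x - 1/2)\<^sup>2 - ?e\<^sup>2 = (2 * (r * x) - 1 + r/2 - r\<^sup>2/2) * (1 - 3/2 * r + r\<^sup>2/2)"
    by (simp add: power2_eq_square field_simps)
  also have "\<dots> \<le> (2 * loss) * (1/2)"
  proof (intro mult_mono)
    show "2 * (r * x) - 1 + r/2 - r\<^sup>2/2 \<le> 2 * loss" using rx by (simp add: loss_def max_def field_simps)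
    have "r * r \<le> 0.44 * 0.44" using r_pos upper by (intro mult_mono) auto
    then show "1 - 3/2 * r + r\<^sup>2/2 \<le> 1/2" using lower by (simp add: power2_eq_square)
    show "0 \<le> 1 - 3/2 * r + r\<^sup>2/2" using upper zero_le_power2[of r] by simp
  qed (use loss_nonneg in simp)
  finally have "r\<^sup>2 * (x - 1/2)\<^sup>2 - loss \<le> ?e\<^sup>2" by simp
  also have "?e\<^sup>2 \<le> (?e + s)\<^sup>2" using e s by (intro power_mono) auto
  finally show ?thesis .
qed

lemma sibling_loss:
  assumes x: "x \<in> {0..1}" and v: "v \<in> {r/2..1 - r/2}" and ij: "i \<in> {1, 2}" "j \<in> {1, 2}" "i \<noteq> j"
  shows "r\<^sup>2 * (x - 1/2)\<^sup>2 - loss \<le> (Sw r [i] x - Sw r [j] v)\<^sup>2"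
proof (cases "i = 1")
  case True
  have "0 \<le> r * (v - r/2)" using v r_pos by (intro mult_nonneg_nonneg) auto
  from sibling_estimate[OF x this]
  have "r\<^sup>2 * (x - 1/2)\<^sup>2 - loss \<le> (r * v + (1 - r) - r * x)\<^sup>2"
    by (simp add: power2_eq_square[of r] algebra_simps)
  then show ?thesis using True ij by (auto simp: S1_def S2_def power2_commute)
next
  case False
  have "0 \<le> r * (1 - r/2 - v)" using v r_pos by (intro mult_nonneg_nonneg) auto
  moreover have "1 - x \<in> {0..1}" using x by auto
  ultimately have "r\<^sup>2 * (1 - x - 1/2)\<^sup>2 - loss \<le> (1 - r + r\<^sup>2/2 - r * (1 - x) + r * (1 - r/2 - v))\<^sup>2"
    by (rule sibling_estimate[rotated])
  moreover have "(1 - x - 1/2)\<^sup>2 = (x - 1/2)\<^sup>2" by (simp add: power2_eq_square algebra_simps)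
  moreover have "1 - r + r\<^sup>2/2 - r * (1 - x) + r * (1 - r/2 - v) = r * x + (1 - r) - r * v"
    by (simp add: power2_eq_square algebra_simps)
  ultimately show ?thesis using False ij by (auto simp: S1_def S2_def)
qed

lemma sibling_midpoint:
  assumes x: "x \<in> {0..1}" and ij: "i \<in> {1, 2}" "j \<in> {1, 2}" "i \<noteq> j"
  shows "r\<^sup>2 * (x - 1/2)\<^sup>2 \<le> (Sw r [i] x - Sw r [j] (1/2))\<^sup>2"
proof -
  have rx: "0 \<le> r * x" "r * x \<le> r" using x r_pos by (auto simp: mult_left_le)
  have "\<bar>r * x - r/2\<bar> \<le> \<bar>Sw r [i] x - Sw r [j] (1/2)\<bar>"
    using ij rx r_half by (auto simp: S1_def S2_def)
  then have "(r * x - r/2)\<^sup>2 \<le> (Sw r [i] x - Sw r [j] (1/2))\<^sup>2" by (simp only: abs_le_square_iff)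
  then show ?thesis by (simp add: power_mult_distrib[symmetric] right_diff_distrib)
qed

text \<open>Points in different cylinders of one level do not compete one level further down: the gap that
  separates them is at least \<open>(1 - 2 r) r ^ m\<close>, which exceeds half the length \<open>r ^ (m + 2)\<close> of a
  cylinder one level below the words \<open>u\<close> and \<open>w\<close>.\<close>

lemma non_sibling:
  assumes uw: "u \<in> words (Suc m)" "w \<in> words (Suc m)" "u \<noteq> w"
    and xyv: "x \<in> {0..1}" "y \<in> {0..1}" "v \<in> {0..1}"
  shows "r ^ (2 * (m + 2)) * (x - 1/2)\<^sup>2 \<le> (Sw r u y - Sw r w v)\<^sup>2"
proof -
  have "r * r \<le> 0.45 * 0.45" using r_pos upper by (intro mult_mono) auto
  then have gap: "r\<^sup>2 / 2 \<le> 1 - 2 * r" using upper by (simp add: power2_eq_square)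
  have "\<bar>x - 1/2\<bar> \<le> 1/2" using xyv(1) unfolding atLeastAtMost_iff by linarith
  then have "\<bar>r ^ (m + 2) * (x - 1/2)\<bar> \<le> r ^ (m + 2) * (1/2)"
    unfolding abs_mult using r_pos by (intro mult_mono) auto
  also have "\<dots> = r\<^sup>2 / 2 * r ^ m" by (simp add: power_add power2_eq_square)
  also have "\<dots> \<le> (1 - 2 * r) * r ^ m" using gap r_pos by (intro mult_right_mono) auto
  also have "\<dots> \<le> \<bar>Sw r u y - Sw r w v\<bar>"
    using separation[of u w y v] parallel_of_same_length[of u w] uw xyv by (auto simp: words_def)
  finally have "(r ^ (m + 2) * (x - 1/2))\<^sup>2 \<le> (Sw r u y - Sw r w v)\<^sup>2" by (simp only: abs_le_square_iff)
  then show ?thesis by (simp only: power_mult_distrib power_mult[symmetric] mult.commute[of 2])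
qed

context
  fixes n k :: nat and I' :: "nat list set"
  assumes n: "ell n = Suc k" "2 ^ Suc k < n" "n < 2 ^ Suc (Suc k)"
    and I': "beta_index n I'"
begin

lemma beta_setE:
  assumes "b \<in> beta_set r n I'"
  obtains w v where "w \<in> words (Suc k)" "b = Sw r w v"
    "w \<notin> I' \<and> v = 1/2 \<or> w \<in> I' \<and> (\<exists>m\<in>{1, 2}. v = Sw r [m] (1/2))"
proof -
  have I'w: "I' \<subseteq> words (Suc k)" using I' n by (simp add: beta_index_def)
  consider (mid) w where "w \<in> words (Suc k)" "w \<notin> I'" "b = Sw r w (1/2)"
    | (split) w m where "w \<in> I'" "m \<in> {1, 2}" "b = Sw r (w @ [m]) (1/2)"
    using assms n unfolding beta_set_def by auto
  then show ?thesis
  proof cases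
    case mid
    then show ?thesis using that[of w "1/2"] by blast
  next
    case split
    then show ?thesis using that[of w "Sw r [m] (1/2)"] I'w unfolding Sw_append by blast
  qed
qed

lemma finite_beta: "finite (beta_set r n I')"
proof -
  have "finite (words (Suc k) - I')" "finite I'"
    using finite_words I' n by (auto simp: beta_index_def intro: finite_subset)
  then show ?thesis unfolding beta_set_def n(1) by (auto simp: setcompr_eq_image)
qed

lemma beta_nonempty: "beta_set r n I' \<noteq> {}"
proof -
  have "card I' > 0" using I' n by (simp add: beta_index_def)
  then obtain w where "w \<in> I'" by (metis card_gt_0_iff ex_in_conv)
  then show ?thesis unfolding beta_set_def by blast
qed

text \<open>For a split cylinder no loss occurs. Its two midpoints are symmetric about its central gap, and
  points of other cylinders are farther away than half the length of one of its halves.\<close>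

lemma beta_cell_split:
  assumes "\<sigma> \<in> I'"
  shows "r ^ (2 * k) * (r ^ 4 * V) \<le> cell (beta_set r n I') \<sigma>"
proof -
  have \<sigma>: "\<sigma> \<in> words (Suc k)" using assms I' n by (auto simp: beta_index_def)
  have "r ^ (2 * (k + 2)) * V - 0 \<le> cell (beta_set r n I') (\<sigma> @ [m])" if m: "m \<in> {1, 2}" for m
  proof (rule cell_ge[OF finite_beta beta_nonempty])
    fix x b :: real assume x: "x \<in> {0..1}" and b: "b \<in> beta_set r n I'"
    obtain w v where w: "w \<in> words (Suc k)" "b = Sw r w v"
      "w \<notin> I' \<and> v = 1/2 \<or> w \<in> I' \<and> (\<exists>m\<in>{1, 2}. v = Sw r [m] (1/2))"
      by (rule beta_setE[OF b])
    show "r ^ (2 * (k + 2)) * (x - 1/2)\<^sup>2 - 0 \<le> (Sw r (\<sigma> @ [m]) x - b)\<^sup>2"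
    proof (cases "w = \<sigma>")
      case True
      then obtain m' where m': "m' \<in> {1, 2}" "v = Sw r [m'] (1/2)" using w assms by blast
      have "r\<^sup>2 * (x - 1/2)\<^sup>2 \<le> (Sw r [m] x - Sw r [m'] (1/2))\<^sup>2"
      proof (cases "m = m'")
        case True
        show ?thesis unfolding True Sw_diff by (simp add: power_mult_distrib)
      qed (use sibling_midpoint[OF x m m'(1)] in auto)
      then have "(r ^ Suc k)\<^sup>2 * (r\<^sup>2 * (x - 1/2)\<^sup>2) \<le> (r ^ Suc k)\<^sup>2 * (Sw r [m] x - Sw r [m'] (1/2))\<^sup>2"
        by (intro mult_left_mono) auto
      moreover have "length \<sigma> = Suc k" using \<sigma> by (simp add: words_def)
      ultimately have "(r ^ Suc k)\<^sup>2 * (r\<^sup>2 * (x - 1/2)\<^sup>2) \<le> (Sw r (\<sigma> @ [m]) x - b)\<^sup>2"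
        unfolding w(2) True m'(2) Sw_append Sw_diff[of r \<sigma>] power_mult_distrib by simp
      moreover have "(r ^ Suc k)\<^sup>2 * r\<^sup>2 = r ^ (2 * (k + 2))"
        by (simp only: power_mult[symmetric] power_add[symmetric]) (simp add: mult.commute)
      ultimately show ?thesis by (simp only: mult.assoc[symmetric] diff_0_right)
    next
      case False
      have half: "(1/2::real) \<in> {0..1}" by simp
      have "v \<in> {0..1}" using w(3) half Sw_unit[OF half] by blast
      then show ?thesis
        unfolding w(2) Sw_append diff_0_right by (rule non_sibling[OF \<sigma> w(1) False[symmetric] x Sw_unit[OF x]])
    qed
  qed
  from this[of 1] this[of 2] cell_split[OF finite_beta beta_nonempty, of \<sigma>]
  have "r ^ (2 * (k + 2)) * V \<le> cell (beta_set r n I') \<sigma>" by simp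
  moreover have "2 * (k + 2) = 2 * k + 4" by simp
  then have "r ^ (2 * (k + 2)) = r ^ (2 * k) * r ^ 4" by (simp only: power_add)
  ultimately show ?thesis by (simp only: mult.assoc)
qed

lemma beta_cell_midpoint:
  assumes \<tau>: "\<tau> \<in> words k" and ij: "i \<in> {1, 2}" "j \<in> {1, 2}" "i \<noteq> j" and notin: "\<tau> @ [i] \<notin> I'"
  shows "r ^ (2 * k) * (r\<^sup>2 * V - (if \<tau> @ [j] \<in> I' then loss else 0)) \<le> cell (beta_set r n I') (\<tau> @ [i])"
proof -
  let ?t = "if \<tau> @ [j] \<in> I' then loss else 0"
  have len: "length \<tau> = k" using \<tau> by (simp add: words_def)
  have "r ^ (2 * k) * r\<^sup>2 * V - r ^ (2 * k) * ?t \<le> cell (beta_set r n I') (\<tau> @ [i])"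
  proof (rule cell_ge[OF finite_beta beta_nonempty])
    fix x b :: real assume x: "x \<in> {0..1}" and b: "b \<in> beta_set r n I'"
    obtain w v where w: "w \<in> words (Suc k)" "b = Sw r w v"
      "w \<notin> I' \<and> v = 1/2 \<or> w \<in> I' \<and> (\<exists>m\<in>{1, 2}. v = Sw r [m] (1/2))"
      by (rule beta_setE[OF b])
    have v: "v \<in> {r/2..1 - r/2}"
      using w(3) r_half by (auto simp: S1_def S2_def)
    obtain \<tau>' j' where \<tau>': "w = \<tau>' @ [j']" "\<tau>' \<in> words k" "j' \<in> {1, 2}"
      using w(1) by (rule words_SucE)
    have scale: "(r ^ k)\<^sup>2 = r ^ (2 * k)" by (simp add: power_mult[symmetric] mult.commute)
    have "r ^ (2 * k) * (r\<^sup>2 * (x - 1/2)\<^sup>2 - ?t) \<le> (Sw r (\<tau> @ [i]) x - b)\<^sup>2"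
    proof (cases "\<tau>' = \<tau>")
      case True
      have "r\<^sup>2 * (x - 1/2)\<^sup>2 - ?t \<le> (Sw r [i] x - Sw r [j'] v)\<^sup>2"
      proof (cases "j' = i")
        case True
        then have v: "v = 1/2" using w(3) notin \<tau>' \<open>\<tau>' = \<tau>\<close> by auto
        show ?thesis unfolding True v Sw_diff using loss_nonneg by (simp add: power_mult_distrib)
      next
        case False
        then have j': "j' = j" using ij \<tau>'(3) by auto
        show ?thesis
        proof (cases "\<tau> @ [j] \<in> I'")
          case True
          then show ?thesis using sibling_loss[OF x v ij] j' by simp
        next
          case False
          then have v: "v = 1/2" using w(3) \<tau>' \<open>\<tau>' = \<tau>\<close> j' by auto
          show ?thesis unfolding j' v using sibling_midpoint[OF x ij] False by simp
        qed
      qed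
      then have "r ^ (2 * k) * (r\<^sup>2 * (x - 1/2)\<^sup>2 - ?t) \<le> r ^ (2 * k) * (Sw r [i] x - Sw r [j'] v)\<^sup>2"
        using r_pos by (intro mult_left_mono) auto
      then show ?thesis
        unfolding w(2) \<tau>'(1) True Sw_append Sw_diff[of r \<tau>] power_mult_distrib len scale .
    next
      case False
      then obtain m where m: "k = Suc m" using \<tau> \<tau>'(2) by (cases k) (auto simp: words_0)
      have "v \<in> {0..1}" using v r_pos by auto
      then have "r ^ (2 * (m + 2)) * (x - 1/2)\<^sup>2 \<le> (Sw r (\<tau> @ [i]) x - b)\<^sup>2"
        unfolding w(2) \<tau>'(1) Sw_append
        using \<tau> \<tau>'(2) False x Sw_unit[OF x] Sw_unit[of v] unfolding m
        by (intro non_sibling) blast+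
      moreover have "r ^ (2 * (m + 2)) = r ^ (2 * k) * r\<^sup>2"
        unfolding m by (simp only: power_add[symmetric]) simp
      ultimately have "r ^ (2 * k) * (r\<^sup>2 * (x - 1/2)\<^sup>2) \<le> (Sw r (\<tau> @ [i]) x - b)\<^sup>2"
        by (simp only: mult.assoc)
      moreover have "0 \<le> r ^ (2 * k) * ?t" using r_pos loss_nonneg by simp
      ultimately show ?thesis unfolding right_diff_distrib by linarith
    qed
    then show "r ^ (2 * k) * r\<^sup>2 * (x - 1/2)\<^sup>2 - r ^ (2 * k) * ?t \<le> (Sw r (\<tau> @ [i]) x - b)\<^sup>2"
      by (simp only: right_diff_distrib mult.assoc)
  qed
  then show ?thesis by (simp only: right_diff_distrib mult.assoc)
qed

text \<open>A loss occurs only on an unsplit cylinder whose sibling is split. The number of such cylinders is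
  at most the number of split and at most the number of unsplit cylinders. Both bounds matter: the
  advantage of \<open>\<alpha>\<^sub>n(I)\<close> is proportional to the first number in one range of \<open>n\<close> and to the second
  in the other range.\<close>

lemma distortion_beta_ge:
  defines "h \<equiv> (r\<^sup>2 - r ^ 4) * V" and "N \<equiv> 2 * 2 ^ k :: real"
  shows "r ^ (2 * k) / N * (N * (r\<^sup>2 * V) - h * card I' - loss * min (real (card I')) (N - card I'))
    \<le> distortion P (beta_set r n I')"
proof -
  let ?E = "cell (beta_set r n I')" and ?R = "r ^ (2 * k)"
  define s where "s w = (if w \<in> I' then 1 else 0 :: real)" for w
  have R: "0 < ?R" using r_pos by simp
  have "card I' = (\<Sum>w\<in>words (Suc k). s w)"
    using I' n finite_words[of "Suc k"]
    by (simp add: s_def sum.If_cases beta_index_def Int_absorb1)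
  then have card: "real (card I') = (\<Sum>\<tau>\<in>words k. s (\<tau> @ [1]) + s (\<tau> @ [2]))"
    by (simp only: sum_words_Suc_snoc)
  have cardw: "N = (\<Sum>\<tau>\<in>words k. 2)" by (simp add: N_def card_words)
  \<comment> \<open>A pair of siblings with exactly one split contributes one to both of the choices of \<open>t\<close>; the
    other pairs have no loss.\<close>
  have pair: "?R * (2 * (r\<^sup>2 * V) - h * (s (\<tau> @ [1]) + s (\<tau> @ [2])) - loss * t)
      \<le> ?E (\<tau> @ [1]) + ?E (\<tau> @ [2])"
    if \<tau>: "\<tau> \<in> words k" and t: "t = s (\<tau> @ [1]) + s (\<tau> @ [2]) \<or> t = 2 - (s (\<tau> @ [1]) + s (\<tau> @ [2]))" for \<tau> t
  proof -
    have h: "r ^ 4 * V = r\<^sup>2 * V - h" by (simp add: h_def algebra_simps)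
    have *: "?R * (r\<^sup>2 * V - h * s (\<tau> @ [i]) - loss * ((1 - s (\<tau> @ [i])) * s (\<tau> @ [j]))) \<le> ?E (\<tau> @ [i])"
      if ij: "i \<in> {1, 2}" "j \<in> {1, 2}" "i \<noteq> j" for i j
      using beta_cell_split[of "\<tau> @ [i]"] beta_cell_midpoint[OF \<tau> ij] unfolding h
      by (auto simp: s_def split: if_splits)
    have "?R * (2 * (r\<^sup>2 * V) - h * (s (\<tau> @ [1]) + s (\<tau> @ [2])) - loss * t)
      \<le> ?R * (r\<^sup>2 * V - h * s (\<tau> @ [1]) - loss * ((1 - s (\<tau> @ [1])) * s (\<tau> @ [2]))
        + (r\<^sup>2 * V - h * s (\<tau> @ [2]) - loss * ((1 - s (\<tau> @ [2])) * s (\<tau> @ [1]))))"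
      using R loss_nonneg t by (intro mult_left_mono) (auto simp: s_def)
    also have "\<dots> \<le> ?E (\<tau> @ [1]) + ?E (\<tau> @ [2])"
      unfolding distrib_left[of ?R] by (intro add_mono *) auto
    finally show ?thesis .
  qed
  have "distortion P (beta_set r n I') = (\<Sum>w\<in>words (Suc k). (1/2) ^ Suc k * ?E w)"
    by (rule distortion_cells[OF finite_beta beta_nonempty])
  also have "\<dots> = (\<Sum>\<tau>\<in>words k. ?E (\<tau> @ [1]) + ?E (\<tau> @ [2])) / N"
    by (simp add: sum_words_Suc_snoc N_def sum_divide_distrib add_divide_distrib power_one_over)
  finally have dist: "distortion P (beta_set r n I') = \<dots>" .
  have bound: "?R / N * (N * (r\<^sup>2 * V) - h * card I' - loss * (\<Sum>\<tau>\<in>words k. t \<tau>)) \<le> distortion P (beta_set r n I')"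
    if "\<And>\<tau>. t \<tau> = s (\<tau> @ [1]) + s (\<tau> @ [2]) \<or> t \<tau> = 2 - (s (\<tau> @ [1]) + s (\<tau> @ [2]))" for t
  proof -
    have "?R * (N * (r\<^sup>2 * V) - h * card I' - loss * (\<Sum>\<tau>\<in>words k. t \<tau>))
      = (\<Sum>\<tau>\<in>words k. ?R * (2 * (r\<^sup>2 * V) - h * (s (\<tau> @ [1]) + s (\<tau> @ [2])) - loss * t \<tau>))"
      unfolding card cardw by (simp only: sum_distrib_left[symmetric] sum_subtractf sum_distrib_right)
    also have "\<dots> \<le> (\<Sum>\<tau>\<in>words k. ?E (\<tau> @ [1]) + ?E (\<tau> @ [2]))"
      using that by (intro sum_mono pair) auto
    finally show ?thesis unfolding dist
      by (simp add: divide_right_mono N_def del: distrib_left)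
  qed
  show ?thesis
    using bound[of "\<lambda>\<tau>. s (\<tau> @ [1]) + s (\<tau> @ [2])"] bound[of "\<lambda>\<tau>. 2 - (s (\<tau> @ [1]) + s (\<tau> @ [2]))"]
    unfolding sum_subtractf card[symmetric] cardw[symmetric] by (simp add: min_def)
qed

end

section \<open>The comparison\<close>

lemma finite_admissible:
  assumes "admissible_choice r P A" "\<sigma> \<in> lists {1, 2}"
  shows "finite (A \<sigma>)"
  using assms unfolding admissible_choice_def A_left_def A_right_def
  by (metis finite.emptyI finite.insertI)

lemma admissible_nonempty:
  assumes "admissible_choice r P A" "\<sigma> \<in> lists {1, 2}"
  shows "A \<sigma> \<noteq> {}"
  using assms unfolding admissible_choice_def A_left_def A_right_def
  by (metis insert_not_empty)

lemma finite_alpha_set: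
  assumes n: "ell n = Suc k" and A: "admissible_choice r P A" and I: "alpha_index n I"
  shows "finite (alpha_set r A n I)"
proof -
  have Iw: "I \<subseteq> words k" using I n by (simp add: alpha_index_def)
  have fin: "finite I" "finite (words k - I)" using finite_subset[OF Iw finite_words] finite_words by auto
  have A: "finite (A \<sigma>)" if "\<sigma> \<in> words k" for \<sigma>
    using that by (intro finite_admissible[OF A]) (simp add: words_def)
  have "{Sw r (\<sigma> @ \<tau>) (1/2) |\<sigma> \<tau>. \<sigma> \<in> I \<and> \<tau> \<in> words 2} = (\<lambda>(\<sigma>, \<tau>). Sw r (\<sigma> @ \<tau>) (1/2)) ` (I \<times> words 2)"
    by auto
  then have "finite {Sw r (\<sigma> @ \<tau>) (1/2) |\<sigma> \<tau>. \<sigma> \<in> I \<and> \<tau> \<in> words 2}"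
    using fin finite_words by simp
  then show ?thesis unfolding alpha_set_def n using fin A Iw by auto
qed

lemma cell_midpoint_le:
  assumes "finite \<alpha>" "Sw r w (1/2) \<in> \<alpha>"
  shows "cell \<alpha> w \<le> r ^ (2 * length w) * V"
  using cell_le[OF assms, of w] by simp

lemma cell_two_midpoints:
  assumes "finite \<alpha>" "Sw r (\<sigma> @ [1]) (1/2) \<in> \<alpha>" "Sw r (\<sigma> @ [2]) (1/2) \<in> \<alpha>"
  shows "cell \<alpha> \<sigma> \<le> r ^ (2 * length \<sigma>) * (r\<^sup>2 * V)"
proof -
  have len: "r ^ (2 * length (\<sigma> @ [i])) * V = r ^ (2 * length \<sigma>) * (r\<^sup>2 * V)" for i
    by (simp add: power2_eq_square algebra_simps)
  have "\<alpha> \<noteq> {}" using assms by auto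
  from cell_split[OF assms(1) this, of \<sigma>]
    cell_midpoint_le[OF assms(1,2)] cell_midpoint_le[OF assms(1,3)]
  show ?thesis unfolding len by linarith
qed

lemma cell_four_midpoints:
  assumes "finite \<alpha>" "\<And>\<tau>. \<tau> \<in> words 2 \<Longrightarrow> Sw r (\<sigma> @ \<tau>) (1/2) \<in> \<alpha>"
  shows "cell \<alpha> \<sigma> \<le> r ^ (2 * length \<sigma>) * (r ^ 4 * V)"
proof -
  have "[1,1] \<in> words 2" "[1,2] \<in> words 2" "[2,1] \<in> words 2" "[2,2] \<in> words 2"
    by (auto simp: words_def)
  note mem = this[THEN assms(2)]
  have len: "r ^ (2 * length (\<sigma> @ [i])) * (r\<^sup>2 * V) = r ^ (2 * length \<sigma>) * (r ^ 4 * V)" for i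
    by (simp add: power2_eq_square power4_eq_xxxx algebra_simps)
  have ne: "\<alpha> \<noteq> {}" using mem by auto
  have "cell \<alpha> (\<sigma> @ [i]) \<le> r ^ (2 * length (\<sigma> @ [i])) * (r\<^sup>2 * V)" if "i \<in> {1, 2}" for i
    using that mem by (intro cell_two_midpoints assms(1)) auto
  from cell_split[OF assms(1) ne, of \<sigma>] this[of 1] this[of 2]
  show ?thesis unfolding len by simp
qed

text \<open>Every set \<open>\<alpha>\<^sub>n(I)\<close> treats the cylinders of one level in two ways only.\<close>

lemma distortion_le_two_kinds:
  fixes a b :: real
  assumes \<alpha>: "finite \<alpha>" "\<alpha> \<noteq> {}" and S: "S \<subseteq> words k"
    and a: "\<And>\<sigma>. \<sigma> \<in> S \<Longrightarrow> cell \<alpha> \<sigma> \<le> r ^ (2 * length \<sigma>) * a"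
    and b: "\<And>\<sigma>. \<sigma> \<in> words k - S \<Longrightarrow> cell \<alpha> \<sigma> \<le> r ^ (2 * length \<sigma>) * b"
  shows "distortion P \<alpha> \<le> r ^ (2 * k) / 2 ^ k * (card S * a + (2 ^ k - real (card S)) * b)"
proof -
  have fin: "finite S" using S finite_words by (rule finite_subset)
  have "distortion P \<alpha> = (1/2) ^ k * (\<Sum>w\<in>words k. cell \<alpha> w)"
    unfolding distortion_cells[OF \<alpha>, of k] by (simp only: sum_distrib_left)
  also have "\<dots> \<le> (1/2) ^ k * (\<Sum>w\<in>words k. r ^ (2 * k) * (if w \<in> S then a else b))"
    using a b S by (intro mult_left_mono sum_mono) (auto simp: words_def)
  also have "(\<Sum>w\<in>words k. r ^ (2 * k) * (if w \<in> S then a else b))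
      = r ^ (2 * k) * (\<Sum>w\<in>words k. if w \<in> S then a else b)"
    by (simp only: sum_distrib_left)
  also have "(\<Sum>w\<in>words k. if w \<in> S then a else b) = card (words k - S) * b + card S * a"
    by (simp add: sum.subset_diff[OF S finite_words])
  also have "real (card (words k - S)) = 2 ^ k - real (card S)"
    using card_mono[OF finite_words S] by (simp add: card_Diff_subset[OF fin S] card_words of_nat_diff)
  finally show ?thesis by (simp add: power_one_over field_simps)
qed

lemma alpha_better_than_beta:
  assumes n: "n \<ge> 2" "\<nexists>l::nat. l \<ge> 1 \<and> n = 2 ^ l"
    and A: "admissible_choice r P A" and I: "alpha_index n I" and I': "beta_index n I'"
  shows "distortion P (alpha_set r A n I) < distortion P (beta_set r n I')"
proof -
  obtain k where k: "ell n = Suc k" "2 ^ Suc k < n" "n < 2 ^ Suc (Suc k)"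
    using n by (rule ell_bounds)
  define N h T where "N = (2 * 2 ^ k :: real)" and "h = (r\<^sup>2 - r ^ 4) * V" and "T = V * three_point_error r"
  let ?\<alpha> = "alpha_set r A n I"
  have N: "N > 0" by (simp add: N_def)
  have R: "r ^ (2 * k) > 0" using r_pos by simp
  have normalize: "r ^ (2 * k) / 2 ^ k * y = r ^ (2 * k) / N * (2 * y)" for y
    by (simp add: N_def)
  have Iw: "I \<subseteq> words k" using I k by (simp add: alpha_index_def)
  have fin: "finite ?\<alpha>" by (rule finite_alpha_set[OF k(1) A I])
  have pattern: "cell ?\<alpha> \<sigma> \<le> r ^ (2 * length \<sigma>) * T" if "\<sigma> \<in> words k" "A \<sigma> \<subseteq> ?\<alpha>" for \<sigma>
    unfolding T_def using A that fin
    by (intro cell_three_point[where A = "A \<sigma>"]) (auto simp: admissible_choice_def words_def)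
  have A_ne: "A \<sigma> \<noteq> {}" if "\<sigma> \<in> words k" for \<sigma>
    using that by (intro admissible_nonempty[OF A]) (simp add: words_def)
  \<comment> \<open>Splitting both halves of a block saves \<open>h\<close>; a three-point pattern saves \<open>- V * gain r\<close> more than
    splitting one of them.\<close>
  have T: "T = r\<^sup>2 * V - h / 2 + V * gain r"
    by (simp add: T_def three_point_error_def h_def power2_eq_square power4_eq_xxxx field_simps)
  have I'card: "real (card I') = real n - N"
    using I' k by (simp add: beta_index_def N_def of_nat_diff)
  note beta = distortion_beta_ge[OF k I', folded h_def N_def]
  show ?thesis
  proof (cases "n \<le> 3 * 2 ^ k")
    case True
    have card: "real (card I) = real n - N"
      using I k True by (simp add: alpha_index_def N_def of_nat_diff)
    have "card I > 0" using I k True by (simp add: alpha_index_def)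
    then have c: "real (card I) > 0" by simp
    have \<alpha>: "?\<alpha> = (\<Union>\<sigma>\<in>I. A \<sigma>) \<union> (\<Union>\<sigma>\<in>words k - I. {Sw r (\<sigma> @ [1]) (1/2), Sw r (\<sigma> @ [2]) (1/2)})"
      using True k by (simp add: alpha_set_def)
    obtain \<sigma> where "\<sigma> \<in> I" using c by fastforce
    then have ne: "?\<alpha> \<noteq> {}" unfolding \<alpha> using A_ne[of \<sigma>] Iw by blast
    have "distortion P ?\<alpha> \<le> r ^ (2 * k) / 2 ^ k * (card I * T + (2 ^ k - real (card I)) * (r\<^sup>2 * V))"
    proof (rule distortion_le_two_kinds[OF fin ne Iw])
      show "cell ?\<alpha> \<sigma> \<le> r ^ (2 * length \<sigma>) * T" if "\<sigma> \<in> I" for \<sigma>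
        using that Iw by (intro pattern) (auto simp: \<alpha>)
      show "cell ?\<alpha> \<sigma> \<le> r ^ (2 * length \<sigma>) * (r\<^sup>2 * V)" if "\<sigma> \<in> words k - I" for \<sigma>
        using that by (intro cell_two_midpoints fin) (auto simp: \<alpha>)
    qed
    also have "\<dots> = r ^ (2 * k) / N * (2 * (card I * T + (2 ^ k - real (card I)) * (r\<^sup>2 * V)))"
      by (rule normalize)
    also have "2 * (card I * T + (2 ^ k - real (card I)) * (r\<^sup>2 * V))
      = N * (r\<^sup>2 * V) - h * card I + 2 * (V * gain r) * card I"
      unfolding T N_def by (simp add: algebra_simps)
    also have "r ^ (2 * k) / N * (N * (r\<^sup>2 * V) - h * card I + 2 * (V * gain r) * card I)
      < r ^ (2 * k) / N * (N * (r\<^sup>2 * V) - h * card I' - loss * card I')"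
    proof (intro mult_strict_left_mono)
      have "2 * (V * gain r) + loss < 0" using margin loss_nonneg by linarith
      then have "(2 * (V * gain r) + loss) * card I < 0" using c by (intro mult_neg_pos) auto
      then show "N * (r\<^sup>2 * V) - h * card I + 2 * (V * gain r) * card I < N * (r\<^sup>2 * V) - h * card I' - loss * card I'"
        by (simp add: card I'card algebra_simps)
    qed (use R N in simp)
    also have "\<dots> \<le> r ^ (2 * k) / N * (N * (r\<^sup>2 * V) - h * card I' - loss * min (real (card I')) (N - card I'))"
      using R N loss_nonneg by (intro mult_left_mono diff_left_mono) auto
    also have "\<dots> \<le> distortion P (beta_set r n I')" by (rule beta)
    finally show ?thesis .
  next
    case False
    have card: "real (card I) = real n - 3 * 2 ^ k"
      using I k False by (simp add: alpha_index_def of_nat_diff)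
    have c: "real (card I) < 2 ^ k"
    proof -
      have "real n < real (2 ^ Suc (Suc k))" using k(3) by (simp only: of_nat_less_iff)
      then show ?thesis using card by simp
    qed
    have \<alpha>: "?\<alpha> = (\<Union>\<sigma>\<in>words k - I. A \<sigma>) \<union> {Sw r (\<sigma> @ \<tau>) (1/2) |\<sigma> \<tau>. \<sigma> \<in> I \<and> \<tau> \<in> words 2}"
      using False k by (simp add: alpha_set_def)
    have "words k - I \<noteq> {}"
    proof
      assume "words k - I = {}"
      then have "I = words k" using Iw by auto
      then show False using c by (simp add: card_words)
    qed
    then have ne: "?\<alpha> \<noteq> {}" unfolding \<alpha> using A_ne by auto
    have "distortion P ?\<alpha> \<le> r ^ (2 * k) / 2 ^ k * (card I * (r ^ 4 * V) + (2 ^ k - real (card I)) * T)"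
    proof (rule distortion_le_two_kinds[OF fin ne Iw])
      show "cell ?\<alpha> \<sigma> \<le> r ^ (2 * length \<sigma>) * T" if "\<sigma> \<in> words k - I" for \<sigma>
        using that by (intro pattern) (auto simp: \<alpha>)
      show "cell ?\<alpha> \<sigma> \<le> r ^ (2 * length \<sigma>) * (r ^ 4 * V)" if "\<sigma> \<in> I" for \<sigma>
        using that by (intro cell_four_midpoints fin) (auto simp: \<alpha>)
    qed
    also have "r ^ 4 * V = r\<^sup>2 * V - h" by (simp add: h_def algebra_simps)
    also have "r ^ (2 * k) / 2 ^ k * (card I * (r\<^sup>2 * V - h) + (2 ^ k - real (card I)) * T)
      = r ^ (2 * k) / N * (2 * (card I * (r\<^sup>2 * V - h) + (2 ^ k - real (card I)) * T))"
      by (rule normalize)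
    also have "2 * (card I * (r\<^sup>2 * V - h) + (2 ^ k - real (card I)) * T)
      = N * (r\<^sup>2 * V) - h * card I' + 2 * (V * gain r) * (N - card I')"
      unfolding T N_def card I'card by (simp add: algebra_simps)
    also have "r ^ (2 * k) / N * (N * (r\<^sup>2 * V) - h * card I' + 2 * (V * gain r) * (N - card I'))
      < r ^ (2 * k) / N * (N * (r\<^sup>2 * V) - h * card I' - loss * (N - card I'))"
    proof (intro mult_strict_left_mono)
      have "2 * (V * gain r) + loss < 0" using margin loss_nonneg by linarith
      moreover have "N - card I' > 0" using c by (simp add: card I'card N_def)
      ultimately have "(2 * (V * gain r) + loss) * (N - card I') < 0" by (intro mult_neg_pos)
      then show "N * (r\<^sup>2 * V) - h * card I' + 2 * (V * gain r) * (N - card I')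
          < N * (r\<^sup>2 * V) - h * card I' - loss * (N - card I')"
        by (simp add: algebra_simps)
    qed (use R N in simp)
    also have "\<dots> \<le> r ^ (2 * k) / N * (N * (r\<^sup>2 * V) - h * card I' - loss * min (real (card I')) (N - card I'))"
      using R N loss_nonneg by (intro mult_left_mono diff_left_mono) auto
    also have "\<dots> \<le> distortion P (beta_set r n I')" by (rule beta)
    finally show ?thesis .
  qed
qed

end

theorem proposition4p3:
  fixes r :: real and P :: "real measure" and n :: nat
    and A :: "nat list \<Rightarrow> real set" and I I' :: "nat list set"
  assumes "n \<ge> 2"
    and "\<nexists>l::nat. l \<ge> 1 \<and> n = 2 ^ l"
    and "0.4371985206 < r" and "r \<le> 0.4384471872"
    and "cantor_distribution r P"
    and "admissible_choice r P A"
    and "alpha_index n I"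
    and "beta_index n I'"
  shows "distortion P (alpha_set r A n I) < distortion P (beta_set r n I')"
proof -
  interpret cantor_window r P
    by unfold_locales (use assms in auto)
  show ?thesis by (rule alpha_better_than_beta[OF assms(1,2,6,7,8)])
qed

end
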